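(* Let $D$ be the open unit disk in $\mathbb{C}$. (a) Let $f$ be an analytic function on $D$ and let $\mu\in M$. Then $f(z)-f(0)=J_\mu(z)$ if and only if $f'(z)=K_\mu(z)$ (for $z\in D$). (b) $J\subset F_\alpha$ for every $\alpha\ge 0$. (c) Let $-1<a<1$ and $\phi_a(z)=\frac{z+a}{1+za}$. If $f\in J$, then $f\circ\phi_a\in J$.
   Context: $D$ is the open unit disk in the complex plane and $T$ is the unit circle. $M$ is the Banach space of all complex-valued Borel measures on $T$ with the usual variation norm. For $\mu\in M$ and $z\in D$ define $$J_\mu(z)=\int_T \log\left(\frac{1-\xi z}{1-\overline{\xi}z}\right)d\mu(\xi),\qquad K_\mu(z)=\int_T\left(\frac{1}{\xi-z}-\frac{\xi}{1-\xi z}\right)d\mu(\xi)=\int_T\frac{1-\xi^2}{(\xi-z)(1-\xi z)}\,d\mu(\xi),$$ and set $$J=\{f: f=J_\mu,\ \mu\in M\}.$$ For $\alpha>0$, $F_\alpha$ is the family of functions $f$ analytic in $D$ for which there exists $\mu\in M$ such that $f(z)=\int_T \frac{1}{(1-\overline{\xi}z)^\alpha}\,d\mu(\xi)$ for $z\in D$. For $\alpha=0$, $F_0$ is the family of functions $f$ analytic in $D$ for which there exists $\mu\in M$ such that $f(z)=f(0)+\int_T\log\left(\frac{1}{1-\overline{\xi}z}\right)d\mu(\xi)$ for $z\in D$. Logarithms and powers are principal branches.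
   Formalization: In (c), the conclusion is that f∘φ_a − f(a) lies in J, not f∘φ_a itself: every J_μ vanishes at 0 while (f∘φ_a)(0)=f(a) need not (e.g. μ the unit mass at i, a=1/2), so (c) as printed is false; it holds up to this additive constant. *)

theory Defs
  imports "HOL-Analysis.Analysis"
begin

text \<open>
  Complex measures are complex-valued, countably additive set functions on a sigma-algebra
  (only the values on \<open>sets N\<close> matter). They are automatically finite.
\<close>

definition complex_measure :: "'a measure \<Rightarrow> ('a set \<Rightarrow> complex) \<Rightarrow> bool" where
  "complex_measure N \<mu> \<longleftrightarrow> \<mu> {} = 0 \<and>
     (\<forall>A :: nat \<Rightarrow> 'a set. range A \<subseteq> sets N \<longrightarrow> disjoint_family A \<longrightarrow>
        (\<lambda>i. \<mu> (A i)) sums \<mu> (\<Union>i. A i))"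

text \<open>
  The upper variation \<open>\<nu>\<^sup>+(A) = sup {\<nu>(B) | B \<subseteq> A}\<close> of a real-valued signed measure \<open>\<nu>\<close>. Since
  \<open>\<nu> {} = 0\<close>, the truncation of negative values by \<open>ennreal\<close> does not change the supremum. The lower
  variation \<open>\<nu>\<^sup>-\<close> is the upper variation of \<open>-\<nu>\<close>, and \<open>\<nu> = \<nu>\<^sup>+ - \<nu>\<^sup>-\<close> is the Jordan decomposition.
\<close>

definition upper_variation :: "'a measure \<Rightarrow> ('a set \<Rightarrow> real) \<Rightarrow> 'a measure" where
  "upper_variation N \<nu> =
     measure_of (space N) (sets N) (\<lambda>A. SUP B\<in>{B \<in> sets N. B \<subseteq> A}. ennreal (\<nu> B))"

definition signed_integral :: "'a measure \<Rightarrow> ('a set \<Rightarrow> real) \<Rightarrow> ('a \<Rightarrow> complex) \<Rightarrow> complex" where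
  "signed_integral N \<nu> g =
     integral\<^sup>L (upper_variation N \<nu>) g - integral\<^sup>L (upper_variation N (\<lambda>A. - \<nu> A)) g"

definition complex_integral :: "'a measure \<Rightarrow> ('a set \<Rightarrow> complex) \<Rightarrow> ('a \<Rightarrow> complex) \<Rightarrow> complex" where
  "complex_integral N \<mu> g =
     signed_integral N (\<lambda>A. Re (\<mu> A)) g + \<i> * signed_integral N (\<lambda>A. Im (\<mu> A)) g"

abbreviation unit_disk :: "complex set" where
  "unit_disk \<equiv> ball 0 1"

definition circle_borel :: "complex measure" where
  "circle_borel = restrict_space borel (sphere 0 1)"

definition circle_measures :: "(complex set \<Rightarrow> complex) set" where
  "circle_measures = {\<mu>. complex_measure circle_borel \<mu>}"

definition J_transform :: "(complex set \<Rightarrow> complex) \<Rightarrow> complex \<Rightarrow> complex" where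
  "J_transform \<mu> z =
     complex_integral circle_borel \<mu> (\<lambda>\<xi>. ln ((1 - \<xi> * z) / (1 - cnj \<xi> * z)))"

definition K_transform :: "(complex set \<Rightarrow> complex) \<Rightarrow> complex \<Rightarrow> complex" where
  "K_transform \<mu> z =
     complex_integral circle_borel \<mu> (\<lambda>\<xi>. 1 / (\<xi> - z) - \<xi> / (1 - \<xi> * z))"

text \<open>
  Functions on the disk are total functions on \<^typ>\<open>complex\<close> whose values outside the disk are
  irrelevant: membership in the following families only depends on the restriction to the disk.
  Every member \<open>f\<close> of \<open>J_family\<close> satisfies \<open>f 0 = 0\<close>, because the kernel is \<open>ln 1 = 0\<close> at
  \<open>z = 0\<close>; hence closure under composition with \<open>disk_auto a\<close> (defined below), which maps \<open>0\<close> to \<open>a\<close>, can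
  only hold after subtracting the value at \<open>0\<close>.
\<close>

definition J_family :: "(complex \<Rightarrow> complex) set" where
  "J_family = {f. \<exists>\<mu>\<in>circle_measures. \<forall>z\<in>unit_disk. f z = J_transform \<mu> z}"

definition F_family :: "real \<Rightarrow> (complex \<Rightarrow> complex) set" where
  "F_family \<alpha> = {f. f analytic_on unit_disk \<and>
     (\<exists>\<mu>\<in>circle_measures. \<forall>z\<in>unit_disk.
        f z = (if \<alpha> = 0
               then f 0 + complex_integral circle_borel \<mu> (\<lambda>\<xi>. ln (1 / (1 - cnj \<xi> * z)))
               else complex_integral circle_borel \<mu>
                      (\<lambda>\<xi>. 1 / (1 - cnj \<xi> * z) powr complex_of_real \<alpha>)))}"

definition disk_auto :: "real \<Rightarrow> complex \<Rightarrow> complex" where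
  "disk_auto a z = (z + complex_of_real a) / (1 + z * complex_of_real a)"

end

theory Submission
  imports Defs "HOL-Complex_Analysis.Cauchy_Integral_Formula"
begin

text \<open>
  Everything rests on a flexible description of the functionals \<open>g \<mapsto> \<integral> g d\<mu>\<close> on bounded measurable
  \<open>g\<close>, for \<open>\<mu>\<close> a complex measure: they are exactly the functionals \<open>g \<mapsto> \<integral> h g dS\<close> with \<open>S\<close> a finite
  positive measure and \<open>h\<close> integrable (\<open>represented_complex_integral\<close>,
  \<open>represented_imp_complex_integral\<close>). One direction needs that the variations of a signed measure
  are finite measures; the other that the positive part of a density is the density of the upper
  variation. Such functionals are closed under linear combinations (pass to the sum of the two base
  measures and take Radon-Nikodym derivatives), and every functional \<open>g \<mapsto> \<integral> h(\<omega>) g(X(\<omega>)) dM(\<omega>)\<close> on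
  an arbitrary measure space is one of them (\<open>represented_pushforward\<close>). To show that a function
  belongs to one of the families it therefore suffices to write it as an integral of the kernel
  over any space whatsoever.

  (a) The kernel of \<open>J\<close> equals \<open>ln (1 - \<xi>z) - ln (1 - \<xi>\<^sup>*z)\<close>, where \<open>\<xi>\<^sup>*\<close> is the complex conjugate, and
  its \<open>z\<close>-derivative is the kernel of \<open>K\<close>. Dominated convergence allows differentiation under the
  integral sign, so \<open>J\<^sub>\<mu>\<close> is a primitive of \<open>K\<^sub>\<mu>\<close>, and \<open>J\<^sub>\<mu>(0) = 0\<close>.

  (b) For \<open>\<alpha> = 0\<close>, split the kernel and push the first term forward under conjugation. For \<open>\<alpha> > 0\<close>
  one shows that \<open>ln (1/(1 - u))\<close> is itself an average of the kernels \<open>(1 - \<zeta>\<^sup>*u)\<^sup>-\<^sup>\<alpha>\<close> over the circle,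
  with a measure not depending on \<open>u\<close> (\<open>log_as_power_average\<close>). Differentiation in \<open>u\<close> reduces the identity
  \<open>ln (1/(1 - u)) = \<integral>\<^sub>0\<^sup>1 (1 - t)\<^sup>\<alpha>\<^sup>-\<^sup>1 ((1 - tu)\<^sup>-\<^sup>\<alpha> - 1)/t dt\<close> to an elementary integral, and Cauchy's formula
  expresses \<open>(G(t) - G(0))/t\<close> as an average of \<open>G\<close> over the circle with density \<open>q\<^sub>t\<close>, namely the Poisson
  kernel minus 1, divided by \<open>t\<close>. The densities \<open>q\<^sub>t\<close> are bounded in \<open>L\<^sup>1\<close> uniformly in \<open>t\<close>, since the
  Poisson kernel is positive with mean 1; this is what makes the combined measure finite for every
  \<open>\<alpha> > 0\<close>. A convolution on the circle (\<open>represented_convolution\<close>) then transports the average to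
  all logarithms \<open>ln (1/(1 - \<xi>\<^sup>*z))\<close> at once.

  (c) For \<open>\<eta> = \<phi>\<^sub>-\<^sub>a(\<xi>)\<close>, again a point of the circle, \<open>(1 - \<xi>\<phi>\<^sub>a(z)) (1 + az) = (1 - \<xi>a) (1 - \<eta>z)\<close>.
  All four factors lie in the right half plane, so the principal logarithms add up without
  correction, and the \<open>J\<close> kernel at \<open>(\<xi>, \<phi>\<^sub>a(z))\<close> minus its value at \<open>z = 0\<close> is the \<open>J\<close> kernel at \<open>(\<eta>, z)\<close>.
  Hence \<open>f \<circ> \<phi>\<^sub>a - f(\<phi>\<^sub>a(0))\<close> arises from the pushforward under \<open>\<phi>\<^sub>-\<^sub>a\<close>.
\<close>

section \<open>Functionals given by complex densities\<close>

text \<open>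
  The test functions of the integrals: measurable and bounded on the space.
\<close>

definition bounded_measurable :: "'a measure \<Rightarrow> ('a \<Rightarrow> complex) \<Rightarrow> bool" where
  "bounded_measurable N g \<longleftrightarrow> g \<in> borel_measurable N \<and> (\<exists>C. \<forall>x\<in>space N. norm (g x) \<le> C)"

text \<open>
  The functional \<open>L\<close> is integration against the complex measure \<open>h dS\<close>, as far as bounded measurable
  functions are concerned; its values on other functions are left open.
\<close>

definition represented :: "'a measure \<Rightarrow> (('a \<Rightarrow> complex) \<Rightarrow> complex) \<Rightarrow> bool" where
  "represented N L \<longleftrightarrow> (\<exists>S h. finite_measure S \<and> sets S = sets N \<and> integrable S h \<and>
     (\<forall>g. bounded_measurable N g \<longrightarrow> L g = (\<integral>x. h x * g x \<partial>S)))"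

text \<open>
  The sum of two measures; it is only meaningful when both live on the same sigma-algebra.
\<close>

definition add_measure :: "'a measure \<Rightarrow> 'a measure \<Rightarrow> 'a measure" where
  "add_measure M N = measure_of (space M) (sets M) (\<lambda>A. emeasure M A + emeasure N A)"

lemma sets_add_measure [simp]: "sets (add_measure M N) = sets M"
  and space_add_measure [simp]: "space (add_measure M N) = space M"
  by (simp_all add: add_measure_def)

lemma emeasure_add_measure:
  assumes "sets M = sets N" "A \<in> sets M"
  shows "emeasure (add_measure M N) A = emeasure M A + emeasure N A"
proof (rule emeasure_measure_of[OF add_measure_def])
  show "sets M \<subseteq> Pow (space M)" by (rule sets.space_closed)
  show "A \<in> sets (add_measure M N)" using assms by simp
  show "positive (sets (add_measure M N)) (\<lambda>A. emeasure M A + emeasure N A)"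
    by (simp add: positive_def)
  show "countably_additive (sets (add_measure M N)) (\<lambda>A. emeasure M A + emeasure N A)"
  proof (rule countably_additiveI)
    fix F :: "nat \<Rightarrow> _" assume F: "range F \<subseteq> sets (add_measure M N)" "disjoint_family F"
    have "(\<Sum>i. emeasure M (F i) + emeasure N (F i))
        = (\<Sum>i. emeasure M (F i)) + (\<Sum>i. emeasure N (F i))"
      by (rule suminf_add[symmetric]) auto
    also have "\<dots> = emeasure M (\<Union>i. F i) + emeasure N (\<Union>i. F i)"
      using F assms(1) by (simp add: suminf_emeasure)
    finally show "(\<Sum>i. emeasure M (F i) + emeasure N (F i))
        = emeasure M (\<Union>i. F i) + emeasure N (\<Union>i. F i)" .
  qed
qed

lemma finite_measure_add_measure:
  assumes "finite_measure M" "finite_measure N" "sets M = sets N"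
  shows "finite_measure (add_measure M N)"
proof
  have "space N = space M" using assms(3) by (metis sets_eq_imp_space_eq)
  moreover have "emeasure M (space M) \<noteq> \<infinity>" "emeasure N (space N) \<noteq> \<infinity>"
    using assms(1,2) by (simp_all add: finite_measure.emeasure_finite)
  ultimately show "emeasure (add_measure M N) (space (add_measure M N)) \<noteq> \<infinity>"
    by (simp add: emeasure_add_measure[OF assms(3)])
qed

text \<open>
  Radon-Nikodym for finite measures, with a real-valued density.
\<close>

lemma finite_measure_eq_density:
  assumes "finite_measure T" "finite_measure S" "absolutely_continuous T S" "sets S = sets T"
  obtains D :: "'a \<Rightarrow> real" where "D \<in> borel_measurable T" "\<And>x. 0 \<le> D x" "density T D = S"
proof -
  interpret T: finite_measure T by fact
  obtain D where D: "D \<in> borel_measurable T" "AE x in T. RN_deriv T S x = ennreal (D x)"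
      "\<And>x. 0 \<le> D x"
    using T.real_RN_deriv[OF assms(2-4)] by blast
  have "density T D = density T (RN_deriv T S)"
    using D by (intro density_cong) auto
  also have "\<dots> = S"
    using T.density_RN_deriv[OF assms(3,4)] .
  finally show ?thesis using that[of D] D by blast
qed

lemma integrable_mult_bounded_measurable:
  fixes h :: "'a \<Rightarrow> complex"
  assumes h: "integrable S h" and g: "g \<in> borel_measurable S" "\<And>x. x \<in> space S \<Longrightarrow> norm (g x) \<le> C"
  shows "integrable S (\<lambda>x. h x * g x)"
proof (rule Bochner_Integration.integrable_bound)
  show "integrable S (\<lambda>x. of_real C * h x)" using h by simp
  show "(\<lambda>x. h x * g x) \<in> borel_measurable S" using h g(1) by measurable
  show "AE x in S. norm (h x * g x) \<le> norm (of_real C * h x)"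
  proof (rule AE_I2)
    fix x assume "x \<in> space S"
    then have "norm (g x) \<le> \<bar>C\<bar>" using g(2) by fastforce
    then show "norm (h x * g x) \<le> norm (of_real C * h x)"
      by (simp add: norm_mult mult.commute mult_right_mono)
  qed
qed

lemma complex_split_mult: "of_real (Re a) * b + \<i> * (of_real (Im a) * b) = a * b"
proof -
  have "of_real (Re a) * b + \<i> * (of_real (Im a) * b) = (of_real (Re a) + \<i> * of_real (Im a)) * b"
    by (simp add: algebra_simps)
  then show ?thesis using complex_eq[of a] by simp
qed

lemma represented_cong:
  assumes "represented N L" "\<And>g. bounded_measurable N g \<Longrightarrow> L g = L' g"
  shows "represented N L'"
proof -
  from assms(1) obtain S h where S: "finite_measure S" "sets S = sets N" "integrable S h"
    and L: "\<And>g. bounded_measurable N g \<Longrightarrow> L g = (\<integral>x. h x * g x \<partial>S)"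
    unfolding represented_def by blast
  have "\<forall>g. bounded_measurable N g \<longrightarrow> L' g = (\<integral>x. h x * g x \<partial>S)"
    using L assms(2) by metis
  then show ?thesis unfolding represented_def using S by blast
qed

lemma represented_scale:
  assumes "represented N L"
  shows "represented N (\<lambda>g. c * L g)"
proof -
  from assms obtain S h where S: "finite_measure S" "sets S = sets N" "integrable S h"
    and L: "\<And>g. bounded_measurable N g \<Longrightarrow> L g = (\<integral>x. h x * g x \<partial>S)"
    unfolding represented_def by blast
  have "c * L g = (\<integral>x. (c * h x) * g x \<partial>S)" if "bounded_measurable N g" for g
    unfolding L[OF that] mult.assoc by (rule integral_mult_right_zero[symmetric])
  then show ?thesis
    unfolding represented_def using S by (intro exI[of _ S] exI[of _ "\<lambda>x. c * h x"]) auto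
qed

lemma represented_add:
  assumes "represented N L1" "represented N L2"
  shows "represented N (\<lambda>g. L1 g + L2 g)"
proof -
  from assms(1) obtain S1 h1 where S1: "finite_measure S1" "sets S1 = sets N" "integrable S1 h1"
    and L1: "\<And>g. bounded_measurable N g \<Longrightarrow> L1 g = (\<integral>x. h1 x * g x \<partial>S1)"
    unfolding represented_def by blast
  from assms(2) obtain S2 h2 where S2: "finite_measure S2" "sets S2 = sets N" "integrable S2 h2"
    and L2: "\<And>g. bounded_measurable N g \<Longrightarrow> L2 g = (\<integral>x. h2 x * g x \<partial>S2)"
    unfolding represented_def by blast
  define T where "T = add_measure S1 S2"
  have eq: "sets S1 = sets S2" using S1 S2 by simp
  have T: "finite_measure T" "sets T = sets N"
    unfolding T_def using S1 S2 finite_measure_add_measure[OF S1(1) S2(1) eq] by auto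
  have eqT: "sets S1 = sets T" "sets S2 = sets T" using S1(2) S2(2) T(2) by simp_all
  have sp: "space T = space N" "space S1 = space N" "space S2 = space N"
    using T(2) S1(2) S2(2) sets_eq_imp_space_eq by blast+
  have null: "emeasure S1 A = 0 \<and> emeasure S2 A = 0" if "A \<in> sets N" "emeasure T A = 0" for A
    using that S1(2) emeasure_add_measure[OF eq] unfolding T_def by simp
  have ac: "absolutely_continuous T S1" "absolutely_continuous T S2"
    unfolding absolutely_continuous_def null_sets_def using null T(2) S1(2) S2(2) by auto
  obtain D1 :: "'a \<Rightarrow> real" where D1: "D1 \<in> borel_measurable T" "\<And>x. 0 \<le> D1 x" "density T D1 = S1"
    using finite_measure_eq_density[OF T(1) S1(1) ac(1) eqT(1)] by metis
  obtain D2 :: "'a \<Rightarrow> real" where D2: "D2 \<in> borel_measurable T" "\<And>x. 0 \<le> D2 x" "density T D2 = S2"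
    using finite_measure_eq_density[OF T(1) S2(1) ac(2) eqT(2)] by metis
  have meas: "f \<in> borel_measurable S1 \<longleftrightarrow> f \<in> borel_measurable T"
       "f \<in> borel_measurable S2 \<longleftrightarrow> f \<in> borel_measurable T"
       "f \<in> borel_measurable N \<longleftrightarrow> f \<in> borel_measurable T" for f :: "'a \<Rightarrow> complex"
    using S1(2) S2(2) T(2) by (simp_all cong: measurable_cong_sets)
  have h: "h1 \<in> borel_measurable T" "h2 \<in> borel_measurable T"
    using meas(1)[of h1] meas(2)[of h2] borel_measurable_integrable[OF S1(3)]
      borel_measurable_integrable[OF S2(3)] by blast+
  have i1: "integrable T (\<lambda>x. D1 x *\<^sub>R f x) \<and> (\<integral>x. f x \<partial>S1) = (\<integral>x. D1 x *\<^sub>R f x \<partial>T)"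
    if "integrable S1 f" for f :: "'a \<Rightarrow> complex"
  proof -
    have f: "f \<in> borel_measurable T"
      using meas(1)[of f] borel_measurable_integrable[OF that] by blast
    have nn: "AE x in T. 0 \<le> D1 x" using D1(2) by simp
    have "integrable (density T D1) f" using that D1(3) by simp
    then show ?thesis
      using integrable_density[OF f D1(1) nn] integral_density[OF f D1(1) nn] unfolding D1(3) by blast
  qed
  have i2: "integrable T (\<lambda>x. D2 x *\<^sub>R f x) \<and> (\<integral>x. f x \<partial>S2) = (\<integral>x. D2 x *\<^sub>R f x \<partial>T)"
    if "integrable S2 f" for f :: "'a \<Rightarrow> complex"
  proof -
    have f: "f \<in> borel_measurable T"
      using meas(2)[of f] borel_measurable_integrable[OF that] by blast
    have nn: "AE x in T. 0 \<le> D2 x" using D2(2) by simp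
    have "integrable (density T D2) f" using that D2(3) by simp
    then show ?thesis
      using integrable_density[OF f D2(1) nn] integral_density[OF f D2(1) nn] unfolding D2(3) by blast
  qed
  let ?h = "\<lambda>x. D1 x *\<^sub>R h1 x + D2 x *\<^sub>R h2 x"
  have "L1 g + L2 g = (\<integral>x. ?h x * g x \<partial>T)" if g: "bounded_measurable N g" for g
  proof -
    obtain C where C: "\<And>x. x \<in> space N \<Longrightarrow> norm (g x) \<le> C"
      using g unfolding bounded_measurable_def by blast
    have gm: "g \<in> borel_measurable S1" "g \<in> borel_measurable S2"
      using g meas unfolding bounded_measurable_def by blast+
    have "integrable S1 (\<lambda>x. h1 x * g x)"
      by (intro integrable_mult_bounded_measurable[OF S1(3) gm(1), where C = C]) (simp add: C sp(2))
    moreover have "integrable S2 (\<lambda>x. h2 x * g x)"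
      by (intro integrable_mult_bounded_measurable[OF S2(3) gm(2), where C = C]) (simp add: C sp(3))
    ultimately show ?thesis
      using L1[OF g] L2[OF g] i1 i2 by (simp add: algebra_simps)
  qed
  moreover have "integrable T ?h"
    using i1[OF S1(3)] i2[OF S2(3)] by simp
  ultimately show ?thesis
    unfolding represented_def using T by (intro exI[of _ T] exI[of _ ?h]) auto
qed

lemma represented_pushforward_nonneg:
  fixes h :: "'b \<Rightarrow> real"
  assumes h: "integrable M h" "\<And>w. 0 \<le> h w" and X: "X \<in> measurable M N"
  shows "represented N (\<lambda>g. \<integral>w. h w *\<^sub>R g (X w) \<partial>M)"
proof -
  define S where "S = distr (density M h) N X"
  have X': "X \<in> measurable (density M h) N" using X by simp
  have hm: "h \<in> borel_measurable M" using h by simp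
  have "finite_measure S"
  proof
    have "emeasure S (space S) = (\<integral>\<^sup>+w. ennreal (h w) \<partial>M)"
      unfolding S_def using X' hm measurable_space[OF X]
      by (subst emeasure_distr)
         (auto simp: emeasure_density vimage_def intro!: nn_integral_cong)
    also have "\<dots> < \<infinity>" using integrableD(2)[OF h(1)] h(2) by (simp add: less_top)
    finally show "emeasure S (space S) \<noteq> \<infinity>" by simp
  qed
  then interpret finite_measure S .
  have "(\<integral>w. h w *\<^sub>R g (X w) \<partial>M) = (\<integral>x. 1 * g x \<partial>S)" if "bounded_measurable N g" for g
  proof -
    have g: "g \<in> borel_measurable N" using that unfolding bounded_measurable_def by blast
    have "(\<integral>x. 1 * g x \<partial>S) = (\<integral>w. g (X w) \<partial>density M h)"
      unfolding S_def using integral_distr[OF X' g] by simp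
    also have "\<dots> = (\<integral>w. h w *\<^sub>R g (X w) \<partial>M)"
      using g X hm h(2) by (intro integral_density) auto
    finally show ?thesis by simp
  qed
  moreover have "integrable S (\<lambda>x. 1 :: complex)" by simp
  moreover have "sets S = sets N" by (simp add: S_def)
  ultimately show ?thesis
    unfolding represented_def using \<open>finite_measure S\<close>
    by (intro exI[of _ S] exI[of _ "\<lambda>_. 1"]) auto
qed

lemma represented_pushforward_real:
  fixes h :: "'b \<Rightarrow> real"
  assumes h: "integrable M h" and X: "X \<in> measurable M N"
  shows "represented N (\<lambda>g. \<integral>w. of_real (h w) * g (X w) \<partial>M)"
proof (rule represented_cong)
  let ?p = "\<lambda>w. max 0 (h w)" and ?n = "\<lambda>w. max 0 (- h w)"
  have pn: "integrable M ?p" "integrable M ?n" using h by auto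
  have "represented N (\<lambda>g. -1 * (\<integral>w. ?n w *\<^sub>R g (X w) \<partial>M))"
    by (intro represented_scale represented_pushforward_nonneg pn X) simp
  then show "represented N (\<lambda>g. (\<integral>w. ?p w *\<^sub>R g (X w) \<partial>M) + -1 * (\<integral>w. ?n w *\<^sub>R g (X w) \<partial>M))"
    by (intro represented_add represented_pushforward_nonneg pn X) simp
  fix g assume g: "bounded_measurable N g"
  then obtain C where C: "\<And>x. x \<in> space N \<Longrightarrow> norm (g x) \<le> C"
    unfolding bounded_measurable_def by blast
  have gm: "(\<lambda>w. g (X w)) \<in> borel_measurable M"
    using g X unfolding bounded_measurable_def by auto
  have "integrable M (\<lambda>w. of_real (k w) * g (X w))" if "integrable M k" for k :: "'b \<Rightarrow> real"
    using that gm C measurable_space[OF X]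
    by (intro integrable_mult_bounded_measurable[where C = C]) auto
  then have i: "integrable M (\<lambda>w. k w *\<^sub>R g (X w))" if "integrable M k" for k :: "'b \<Rightarrow> real"
    using that by (simp add: scaleR_conv_of_real)
  have "(\<integral>w. ?p w *\<^sub>R g (X w) \<partial>M) + -1 * (\<integral>w. ?n w *\<^sub>R g (X w) \<partial>M)
      = (\<integral>w. ?p w *\<^sub>R g (X w) - ?n w *\<^sub>R g (X w) \<partial>M)"
    using i[OF pn(1)] i[OF pn(2)] by simp
  also have "\<dots> = (\<integral>w. of_real (h w) * g (X w) \<partial>M)"
    by (intro Bochner_Integration.integral_cong)
       (auto simp: scaleR_conv_of_real max_def simp flip: left_diff_distrib)
  finally show "(\<integral>w. ?p w *\<^sub>R g (X w) \<partial>M) + -1 * (\<integral>w. ?n w *\<^sub>R g (X w) \<partial>M)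
      = (\<integral>w. of_real (h w) * g (X w) \<partial>M)" .
qed

text \<open>
  The complex measure behind this functional is the image of \<open>h dM\<close> under \<open>X\<close>. No finiteness of \<open>M\<close>
  is needed.
\<close>

lemma represented_pushforward:
  fixes h :: "'b \<Rightarrow> complex"
  assumes h: "integrable M h" and X: "X \<in> measurable M N"
  shows "represented N (\<lambda>g. \<integral>w. h w * g (X w) \<partial>M)"
proof (rule represented_cong)
  have hh: "integrable M (\<lambda>w. Re (h w))" "integrable M (\<lambda>w. Im (h w))" using h by auto
  show "represented N (\<lambda>g. (\<integral>w. of_real (Re (h w)) * g (X w) \<partial>M)
          + \<i> * (\<integral>w. of_real (Im (h w)) * g (X w) \<partial>M))"
    by (intro represented_add represented_scale represented_pushforward_real hh X)
  fix g assume g: "bounded_measurable N g"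
  then obtain C where C: "\<And>x. x \<in> space N \<Longrightarrow> norm (g x) \<le> C"
    unfolding bounded_measurable_def by blast
  have gm: "(\<lambda>w. g (X w)) \<in> borel_measurable M"
    using g X unfolding bounded_measurable_def by auto
  have i: "integrable M (\<lambda>w. of_real (k w) * g (X w))" if "integrable M k" for k :: "'b \<Rightarrow> real"
    using that gm C measurable_space[OF X]
    by (intro integrable_mult_bounded_measurable[where C = C]) auto
  have "(\<integral>w. of_real (Re (h w)) * g (X w) \<partial>M) + \<i> * (\<integral>w. of_real (Im (h w)) * g (X w) \<partial>M)
      = (\<integral>w. of_real (Re (h w)) * g (X w) + \<i> * (of_real (Im (h w)) * g (X w)) \<partial>M)"
    using i[OF hh(1)] i[OF hh(2)] by simp
  also have "\<dots> = (\<integral>w. h w * g (X w) \<partial>M)"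
    by (intro Bochner_Integration.integral_cong refl complex_split_mult)
  finally show "(\<integral>w. of_real (Re (h w)) * g (X w) \<partial>M) + \<i> * (\<integral>w. of_real (Im (h w)) * g (X w) \<partial>M)
      = (\<integral>w. h w * g (X w) \<partial>M)" .
qed

section \<open>Signed and complex measures\<close>

text \<open>
  Countably additive real-valued set functions, in the same encoding as complex measures.
\<close>

definition signed_measure :: "'a measure \<Rightarrow> ('a set \<Rightarrow> real) \<Rightarrow> bool" where
  "signed_measure N \<nu> \<longleftrightarrow> \<nu> {} = 0 \<and>
     (\<forall>A :: nat \<Rightarrow> 'a set. range A \<subseteq> sets N \<longrightarrow> disjoint_family A \<longrightarrow>
        (\<lambda>i. \<nu> (A i)) sums \<nu> (\<Union>i. A i))"

lemma signed_measure_Un: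
  assumes "signed_measure N \<nu>" "A \<in> sets N" "B \<in> sets N" "A \<inter> B = {}"
  shows "\<nu> (A \<union> B) = \<nu> A + \<nu> B"
proof -
  have "range (binaryset A B) \<subseteq> sets N" using assms(2,3) by (simp add: range_binaryset_eq)
  moreover have "disjoint_family (binaryset A B)"
    using assms(4) by (simp add: disjoint_family_on_def binaryset_def) blast
  ultimately have "(\<lambda>i. \<nu> (binaryset A B i)) sums \<nu> (\<Union>i. binaryset A B i)"
    using assms(1) unfolding signed_measure_def by blast
  moreover have "(\<lambda>i. \<nu> (binaryset A B i)) sums (\<nu> A + \<nu> B)"
    using assms(1) unfolding signed_measure_def by (intro binaryset_sums) auto
  ultimately show ?thesis
    by (simp add: sums_unique2 UN_binaryset_eq)
qed

lemma ennreal_le_suminf_ennreal: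
  fixes x :: "nat \<Rightarrow> real"
  assumes "x sums s"
  shows "ennreal s \<le> (\<Sum>i. ennreal (x i))"
proof (rule LIMSEQ_le_const2)
  show "(\<lambda>n. ennreal (\<Sum>i<n. x i)) \<longlonglongrightarrow> ennreal s"
    using assms unfolding sums_def by (rule tendsto_ennrealI)
  have "ennreal (\<Sum>i<n. x i) \<le> (\<Sum>i<n. ennreal (x i))" for n
  proof (induction n)
    case (Suc n)
    have "ennreal ((\<Sum>i<n. x i) + x n) \<le> ennreal (\<Sum>i<n. x i) + ennreal (x n)"
      by (auto simp: ennreal_plus_if simp del: ennreal_plus intro!: ennreal_leI)
    also have "\<dots> \<le> (\<Sum>i<n. ennreal (x i)) + ennreal (x n)"
      using Suc by (rule add_right_mono)
    finally show ?case by simp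
  qed simp
  moreover have "(\<Sum>i<n. ennreal (x i)) \<le> (\<Sum>i. ennreal (x i))" for n
    by (rule sum_le_suminf) auto
  ultimately show "\<exists>N. \<forall>n\<ge>N. ennreal (\<Sum>i<n. x i) \<le> (\<Sum>i. ennreal (x i))"
    by (meson order_trans)
qed

text \<open>
  The set function underlying the upper variation.
\<close>

definition upper_sup :: "'a measure \<Rightarrow> ('a set \<Rightarrow> real) \<Rightarrow> 'a set \<Rightarrow> ennreal" where
  "upper_sup N \<nu> A = (SUP B\<in>{B \<in> sets N. B \<subseteq> A}. ennreal (\<nu> B))"

lemma upper_sup_upper: "B \<in> sets N \<Longrightarrow> B \<subseteq> A \<Longrightarrow> ennreal (\<nu> B) \<le> upper_sup N \<nu> A"
  unfolding upper_sup_def by (intro SUP_upper) auto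

lemma upper_sup_least:
  "(\<And>B. B \<in> sets N \<Longrightarrow> B \<subseteq> A \<Longrightarrow> ennreal (\<nu> B) \<le> c) \<Longrightarrow> upper_sup N \<nu> A \<le> c"
  unfolding upper_sup_def by (intro SUP_least) auto

lemma upper_sup_mono: "A \<subseteq> B \<Longrightarrow> upper_sup N \<nu> A \<le> upper_sup N \<nu> B"
  by (intro upper_sup_least upper_sup_upper) auto

lemma upper_sup_superadditive:
  assumes \<nu>: "signed_measure N \<nu>" and AB: "A \<in> sets N" "B \<in> sets N" "A \<inter> B = {}"
  shows "upper_sup N \<nu> A + upper_sup N \<nu> B \<le> upper_sup N \<nu> (A \<union> B)"
proof -
  let ?P = "\<lambda>A. {C \<in> sets N. C \<subseteq> A}"
  have ne: "?P A \<noteq> {}" "?P B \<noteq> {}" by auto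
  have "ennreal (\<nu> C) + ennreal (\<nu> D) \<le> upper_sup N \<nu> (A \<union> B)"
    if "C \<in> ?P A" "D \<in> ?P B" for C D
  proof -
    have "\<nu> (C \<union> D) = \<nu> C + \<nu> D" using that AB(3) by (intro signed_measure_Un[OF \<nu>]) auto
    moreover have "ennreal (\<nu> (C \<union> D)) \<le> upper_sup N \<nu> (A \<union> B)"
         "ennreal (\<nu> C) \<le> upper_sup N \<nu> (A \<union> B)" "ennreal (\<nu> D) \<le> upper_sup N \<nu> (A \<union> B)"
      using that by (auto intro!: upper_sup_upper)
    ultimately show ?thesis by (auto simp: ennreal_plus_if simp del: ennreal_plus)
  qed
  then have "upper_sup N \<nu> A + ennreal (\<nu> D) \<le> upper_sup N \<nu> (A \<union> B)" if "D \<in> ?P B" for D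
    using that unfolding upper_sup_def[of N \<nu> A] ennreal_SUP_add_left[OF ne(1), symmetric]
    by (intro SUP_least) auto
  then show ?thesis
    unfolding upper_sup_def[of N \<nu> B] ennreal_SUP_add_right[OF ne(2)]
    by (intro SUP_least) auto
qed

lemma countably_additive_upper_sup:
  assumes \<nu>: "signed_measure N \<nu>"
  shows "countably_additive (sets N) (upper_sup N \<nu>)"
proof (rule countably_additiveI)
  fix A :: "nat \<Rightarrow> _" assume A: "range A \<subseteq> sets N" "disjoint_family A" "(\<Union>i. A i) \<in> sets N"
  show "(\<Sum>i. upper_sup N \<nu> (A i)) = upper_sup N \<nu> (\<Union>i. A i)"
  proof (rule antisym)
    have fin: "(\<Sum>i<n. upper_sup N \<nu> (A i)) \<le> upper_sup N \<nu> (\<Union>i<n. A i)" for n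
    proof (induction n)
      case (Suc n)
      have "(\<Sum>i<Suc n. upper_sup N \<nu> (A i)) \<le> upper_sup N \<nu> (\<Union>i<n. A i) + upper_sup N \<nu> (A n)"
        using Suc by (simp add: add_right_mono)
      also have "\<dots> \<le> upper_sup N \<nu> ((\<Union>i<n. A i) \<union> A n)"
      proof (rule upper_sup_superadditive[OF \<nu>])
        show "(\<Union>i<n. A i) \<inter> A n = {}"
        proof -
          have "A i \<inter> A n = {}" if "i < n" for i
            using A(2) that unfolding disjoint_family_on_def by simp
          then show ?thesis by blast
        qed
      qed (use A(1) in auto)
      also have "(\<Union>i<n. A i) \<union> A n = (\<Union>i<Suc n. A i)" by (auto simp: lessThan_Suc)
      finally show ?case .
    qed simp
    show "(\<Sum>i. upper_sup N \<nu> (A i)) \<le> upper_sup N \<nu> (\<Union>i. A i)"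
    proof (rule suminf_le_const)
      show "(\<Sum>i<n. upper_sup N \<nu> (A i)) \<le> upper_sup N \<nu> (\<Union>i. A i)" for n
        by (rule order_trans[OF fin]) (intro upper_sup_mono, auto)
    qed simp
    show "upper_sup N \<nu> (\<Union>i. A i) \<le> (\<Sum>i. upper_sup N \<nu> (A i))"
    proof (rule upper_sup_least)
      fix B assume B: "B \<in> sets N" "B \<subseteq> (\<Union>i. A i)"
      have "range (\<lambda>i. B \<inter> A i) \<subseteq> sets N" using A(1) B(1) by auto
      moreover have "disjoint_family (\<lambda>i. B \<inter> A i)"
        using A(2) unfolding disjoint_family_on_def by blast
      ultimately have "(\<lambda>i. \<nu> (B \<inter> A i)) sums \<nu> (\<Union>i. B \<inter> A i)"
        using \<nu> unfolding signed_measure_def by (elim conjE allE[of _ "\<lambda>i. B \<inter> A i"]) simp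
      also have "(\<Union>i. B \<inter> A i) = B" using B(2) by auto
      finally have "ennreal (\<nu> B) \<le> (\<Sum>i. ennreal (\<nu> (B \<inter> A i)))"
        by (rule ennreal_le_suminf_ennreal)
      also have "\<dots> \<le> (\<Sum>i. upper_sup N \<nu> (A i))"
        using A(1) B(1) by (intro suminf_le upper_sup_upper) auto
      finally show "ennreal (\<nu> B) \<le> (\<Sum>i. upper_sup N \<nu> (A i))" .
    qed
  qed
qed

text \<open>
  A set of infinite upper variation splits into two pieces with \<open>|\<nu>| > 1\<close> on both, one of which has
  infinite upper variation again. Iterating on that piece, the discarded ones are disjoint
  sets on which \<open>\<nu>\<close> does not tend to \<open>0\<close>, contradicting countable additivity.
\<close>

lemma upper_sup_finite:
  assumes \<nu>: "signed_measure N \<nu>" and E: "E \<in> sets N"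
  shows "upper_sup N \<nu> E \<noteq> \<infinity>"
proof
  assume inf: "upper_sup N \<nu> E = \<infinity>"
  define P where "P F \<longleftrightarrow> F \<in> sets N \<and> upper_sup N \<nu> F = \<infinity>" for F
  have step: "\<exists>G. P G \<and> G \<subseteq> F \<and> 1 < \<bar>\<nu> (F - G)\<bar>" if F: "P F" for F
  proof -
    have F': "F \<in> sets N" "upper_sup N \<nu> F = \<infinity>" using F unfolding P_def by auto
    \<comment> \<open>the margin \<open>|\<nu>(F)| + 1\<close> makes \<open>|\<nu>| > 1\<close> on the complement as well\<close>
    have "\<exists>B. B \<in> sets N \<and> B \<subseteq> F \<and> ennreal (\<bar>\<nu> F\<bar> + 1) < ennreal (\<nu> B)"
    proof (rule ccontr)
      assume "\<not> ?thesis"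
      then have "upper_sup N \<nu> F \<le> ennreal (\<bar>\<nu> F\<bar> + 1)"
        by (intro upper_sup_least) (meson not_le)
      then show False using F'(2) by (simp add: top_unique)
    qed
    then obtain B where B: "B \<in> sets N" "B \<subseteq> F" "\<bar>\<nu> F\<bar> + 1 < \<nu> B"
      by (auto simp: ennreal_less_iff simp del: ennreal_plus)
    have FB: "F - B \<in> sets N" using F'(1) B(1) by blast
    have dis: "B \<inter> (F - B) = {}" and un: "B \<union> (F - B) = F" using B(2) by auto
    have sum: "\<nu> F = \<nu> B + \<nu> (F - B)"
      using signed_measure_Un[OF \<nu> B(1) FB dis] un by simp
    have large: "1 < \<bar>\<nu> B\<bar>" "1 < \<bar>\<nu> (F - B)\<bar>" using B(3) sum by linarith+
    have "upper_sup N \<nu> F \<le> upper_sup N \<nu> B + upper_sup N \<nu> (F - B)"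
    proof (rule upper_sup_least)
      fix C assume C: "C \<in> sets N" "C \<subseteq> F"
      have "\<nu> C = \<nu> (C \<inter> B) + \<nu> (C - B)"
        using signed_measure_Un[OF \<nu>, of "C \<inter> B" "C - B"] C B(1) by (auto simp: Int_Diff_Un)
      then have "ennreal (\<nu> C) \<le> ennreal (\<nu> (C \<inter> B)) + ennreal (\<nu> (C - B))"
        by (auto simp: ennreal_plus_if simp del: ennreal_plus intro!: ennreal_leI)
      also have "\<dots> \<le> upper_sup N \<nu> B + upper_sup N \<nu> (F - B)"
        using C B(1) by (intro add_mono upper_sup_upper) auto
      finally show "ennreal (\<nu> C) \<le> upper_sup N \<nu> B + upper_sup N \<nu> (F - B)" .
    qed
    then have "upper_sup N \<nu> B = \<infinity> \<or> upper_sup N \<nu> (F - B) = \<infinity>"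
      using F'(2) by (auto simp: top_unique)
    then show ?thesis
    proof
      assume "upper_sup N \<nu> B = \<infinity>"
      then show ?thesis using B large unfolding P_def by (intro exI[of _ B]) auto
    next
      assume "upper_sup N \<nu> (F - B) = \<infinity>"
      moreover have "F - (F - B) = B" using B(2) by auto
      ultimately show ?thesis using FB large unfolding P_def by (intro exI[of _ "F - B"]) auto
    qed
  qed
  have "\<exists>G. \<forall>n. P (G n) \<and> G (Suc n) \<subseteq> G n \<and> 1 < \<bar>\<nu> (G n - G (Suc n))\<bar>"
    using dependent_nat_choice[of "\<lambda>n. P" "\<lambda>n F G. G \<subseteq> F \<and> 1 < \<bar>\<nu> (F - G)\<bar>"]
      step E inf unfolding P_def by blast
  then obtain G where G: "\<And>n. P (G n)" "\<And>n. G (Suc n) \<subseteq> G n" "\<And>n. 1 < \<bar>\<nu> (G n - G (Suc n))\<bar>"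
    by blast
  have anti: "G m \<subseteq> G n" if "n \<le> m" for m n
    using lift_Suc_antimono_le[of G, OF G(2) that] .
  define H where "H n = G n - G (Suc n)" for n
  have "range H \<subseteq> sets N" using G(1) unfolding H_def P_def by auto
  moreover have "disjoint_family H"
    unfolding disjoint_family_on_def
  proof (intro ballI impI)
    fix m n :: nat assume "m \<noteq> n"
    then consider "Suc m \<le> n" | "Suc n \<le> m" by linarith
    then show "H m \<inter> H n = {}"
    proof cases
      case 1 then show ?thesis using anti[OF 1] unfolding H_def by blast
    next
      case 2 then show ?thesis using anti[OF 2] unfolding H_def by blast
    qed
  qed
  ultimately have "(\<lambda>n. \<nu> (H n)) sums \<nu> (\<Union>n. H n)"
    using \<nu> unfolding signed_measure_def by blast
  then have "(\<lambda>n. \<nu> (H n)) \<longlonglongrightarrow> 0" by (intro summable_LIMSEQ_zero sums_summable)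
  then have "eventually (\<lambda>n. dist (\<nu> (H n)) 0 < 1) sequentially"
    unfolding tendsto_iff by simp
  then obtain n where "dist (\<nu> (H n)) 0 < 1" by (auto simp: eventually_sequentially)
  with G(3)[of n] show False unfolding H_def by simp
qed

lemma sets_upper_variation [simp]: "sets (upper_variation N \<nu>) = sets N"
  and space_upper_variation [simp]: "space (upper_variation N \<nu>) = space N"
  by (simp_all add: upper_variation_def)

lemma emeasure_upper_variation:
  assumes \<nu>: "signed_measure N \<nu>" and A: "A \<in> sets N"
  shows "emeasure (upper_variation N \<nu>) A = upper_sup N \<nu> A"
proof (rule emeasure_measure_of)
  show "upper_variation N \<nu> = measure_of (space N) (sets N) (upper_sup N \<nu>)"
    by (simp add: upper_variation_def upper_sup_def[abs_def])
  have "upper_sup N \<nu> {} = 0"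
    using \<nu> unfolding signed_measure_def by (simp add: upper_sup_def cong: conj_cong)
  then show "positive (sets (upper_variation N \<nu>)) (upper_sup N \<nu>)"
    by (simp add: positive_def)
  show "countably_additive (sets (upper_variation N \<nu>)) (upper_sup N \<nu>)"
    using countably_additive_upper_sup[OF \<nu>] by simp
qed (use A sets.space_closed in auto)

lemma finite_measure_upper_variation:
  assumes "signed_measure N \<nu>"
  shows "finite_measure (upper_variation N \<nu>)"
  by (rule finite_measureI)
     (simp add: emeasure_upper_variation[OF assms] upper_sup_finite[OF assms, unfolded infinity_ennreal_def])

lemma represented_finite_measure:
  assumes "finite_measure S" "sets S = sets N"
  shows "represented N (\<lambda>g. integral\<^sup>L S g)"
proof -
  interpret finite_measure S by fact
  have "integrable S (\<lambda>_. 1 :: complex)" by simp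
  then show ?thesis
    unfolding represented_def using assms by (intro exI[of _ S] exI[of _ "\<lambda>_. 1"]) auto
qed

lemma represented_signed_integral:
  assumes "signed_measure N \<nu>"
  shows "represented N (signed_integral N \<nu>)"
proof -
  have "signed_measure N (\<lambda>A. - \<nu> A)"
    using assms unfolding signed_measure_def by (auto intro: sums_minus)
  then have "represented N (\<lambda>g. integral\<^sup>L (upper_variation N \<nu>) g
      + - 1 * integral\<^sup>L (upper_variation N (\<lambda>A. - \<nu> A)) g)"
    using assms
    by (intro represented_add represented_scale represented_finite_measure
          finite_measure_upper_variation) auto
  then show ?thesis by (rule represented_cong) (simp add: signed_integral_def)
qed

lemma represented_complex_integral:
  assumes "complex_measure N \<mu>"
  shows "represented N (complex_integral N \<mu>)"
proof -
  have "signed_measure N (\<lambda>A. Re (\<mu> A))" "signed_measure N (\<lambda>A. Im (\<mu> A))"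
    using assms unfolding signed_measure_def complex_measure_def
    by (auto intro: sums_Re sums_Im)
  then have "represented N (\<lambda>g. signed_integral N (\<lambda>A. Re (\<mu> A)) g
       + \<i> * signed_integral N (\<lambda>A. Im (\<mu> A)) g)"
    by (intro represented_add represented_scale represented_signed_integral)
  then show ?thesis by (rule represented_cong) (simp add: complex_integral_def)
qed

text \<open>
  The supremum over subsets of \<open>A\<close> is attained at the part of \<open>A\<close> where \<open>h\<close> is positive. The coercion
  \<open>ennreal\<close> truncates negative values, so the density on the right is the positive part of \<open>h\<close>.
\<close>

lemma upper_variation_density:
  fixes h :: "'a \<Rightarrow> real"
  assumes S: "sets S = sets N" and h: "integrable S h"
    and \<nu>: "\<And>A. A \<in> sets N \<Longrightarrow> \<nu> A = (\<integral>x\<in>A. h x \<partial>S)"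
  shows "upper_variation N \<nu> = density S (\<lambda>x. ennreal (h x))"
proof -
  have hm [measurable]: "h \<in> borel_measurable S" using h by simp
  have hA: "integrable S (\<lambda>x. indicator A x *\<^sub>R h x)" if "A \<in> sets N" for A
    using h that S by (intro integrable_mult_indicator) auto
  have sup: "(SUP B\<in>{B \<in> sets N. B \<subseteq> A}. ennreal (\<nu> B)) = emeasure (density S (\<lambda>x. ennreal (h x))) A"
    if A: "A \<in> sets N" for A
  proof -
    have A' [measurable]: "A \<in> sets S" using A S by simp
    \<comment> \<open>the subset of \<open>A\<close> at which the supremum is attained\<close>
    let ?P = "{x \<in> space S. x \<in> A \<and> 0 < h x}"
    have P: "?P \<in> sets S" by measurable
    have em: "emeasure (density S (\<lambda>x. ennreal (h x))) B = (\<integral>\<^sup>+x. ennreal (h x) * indicator B x \<partial>S)"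
      if "B \<in> sets N" for B
      using that S by (intro emeasure_density) auto
    have le: "ennreal (\<nu> B) \<le> emeasure (density S (\<lambda>x. ennreal (h x))) A"
      if B: "B \<in> sets N" "B \<subseteq> A" for B
    proof -
      have "\<nu> B = (\<integral>x. indicator B x *\<^sub>R h x \<partial>S)"
        using \<nu>[OF B(1)] by (simp add: set_lebesgue_integral_def)
      also have "\<dots> \<le> (\<integral>x. max 0 (indicator B x *\<^sub>R h x) \<partial>S)"
        using hA[OF B(1)] by (intro integral_mono) auto
      finally have "ennreal (\<nu> B) \<le> ennreal (\<integral>x. max 0 (indicator B x *\<^sub>R h x) \<partial>S)"
        by (rule ennreal_leI)
      also have "\<dots> = (\<integral>\<^sup>+x. ennreal (max 0 (indicator B x *\<^sub>R h x)) \<partial>S)"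
        using hA[OF B(1)] by (intro nn_integral_eq_integral[symmetric]) auto
      also have "\<dots> \<le> (\<integral>\<^sup>+x. ennreal (h x) * indicator A x \<partial>S)"
        using B(2) by (intro nn_integral_mono) (auto split: split_indicator simp: max_def)
      finally show ?thesis using em[OF A] by simp
    qed
    have "emeasure (density S (\<lambda>x. ennreal (h x))) A = (\<integral>\<^sup>+x. ennreal (indicator ?P x *\<^sub>R h x) \<partial>S)"
      unfolding em[OF A]
      by (intro nn_integral_cong) (auto split: split_indicator simp: ennreal_neg not_less)
    also have "\<dots> = ennreal (\<nu> ?P)"
      using \<nu>[of ?P] P S hA[of ?P] unfolding set_lebesgue_integral_def
      by (subst nn_integral_eq_integral) (auto split: split_indicator)
    finally have "emeasure (density S (\<lambda>x. ennreal (h x))) A = ennreal (\<nu> ?P)" .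
    moreover have "ennreal (\<nu> ?P) \<le> (SUP B\<in>{B \<in> sets N. B \<subseteq> A}. ennreal (\<nu> B))"
      using P S by (intro SUP_upper) auto
    ultimately show ?thesis
      using le by (intro antisym SUP_least) auto
  qed
  have "upper_variation N \<nu> = measure_of (space N) (sets N) (emeasure (density S (\<lambda>x. ennreal (h x))))"
    unfolding upper_variation_def by (intro measure_of_eq sets.space_closed) (simp add: sets.sigma_sets_eq sup)
  also have "\<dots> = density S (\<lambda>x. ennreal (h x))"
    using measure_of_of_measure[of "density S (\<lambda>x. ennreal (h x))"] S sets_eq_imp_space_eq[OF S] by simp
  finally show ?thesis .
qed

lemma signed_integral_density:
  fixes h :: "'a \<Rightarrow> real"
  assumes S: "sets S = sets N" and h: "integrable S h"
    and \<nu>: "\<And>A. A \<in> sets N \<Longrightarrow> \<nu> A = (\<integral>x\<in>A. h x \<partial>S)"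
    and g: "bounded_measurable N g"
  shows "signed_integral N \<nu> g = (\<integral>x. of_real (h x) * g x \<partial>S)"
proof -
  have sp: "space S = space N" using S by (rule sets_eq_imp_space_eq)
  have gm: "g \<in> borel_measurable S"
    using g S unfolding bounded_measurable_def by (simp cong: measurable_cong_sets)
  obtain C where C: "\<And>x. x \<in> space N \<Longrightarrow> norm (g x) \<le> C"
    using g unfolding bounded_measurable_def by blast
  have up: "(\<integral>x. g x \<partial>density S (\<lambda>x. ennreal (k x))) = (\<integral>x. of_real (max 0 (k x)) * g x \<partial>S)"
    and int: "integrable S (\<lambda>x. of_real (max 0 (k x)) * g x)" if k: "integrable S k" for k :: "'a \<Rightarrow> real"
  proof -
    have "density S (\<lambda>x. ennreal (k x)) = density S (\<lambda>x. ennreal (max 0 (k x)))"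
      by (intro arg_cong[where f = "density S"] ext) (simp add: max_def ennreal_neg)
    then show "(\<integral>x. g x \<partial>density S (\<lambda>x. ennreal (k x))) = (\<integral>x. of_real (max 0 (k x)) * g x \<partial>S)"
      using gm k by (simp add: integral_density scaleR_conv_of_real)
    show "integrable S (\<lambda>x. of_real (max 0 (k x)) * g x)"
      using k gm C sp by (intro integrable_mult_bounded_measurable[where C = C]) auto
  qed
  have "upper_variation N \<nu> = density S (\<lambda>x. ennreal (h x))"
    using S h \<nu> by (rule upper_variation_density)
  moreover have "upper_variation N (\<lambda>A. - \<nu> A) = density S (\<lambda>x. ennreal (- h x))"
    using S h \<nu> by (intro upper_variation_density) (auto simp: set_lebesgue_integral_def)
  ultimately have "signed_integral N \<nu> g
      = (\<integral>x. of_real (max 0 (h x)) * g x \<partial>S) - (\<integral>x. of_real (max 0 (- h x)) * g x \<partial>S)"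
    unfolding signed_integral_def using up[OF h] up[of "\<lambda>x. - h x"] h by simp
  also have "\<dots> = (\<integral>x. of_real (max 0 (h x)) * g x - of_real (max 0 (- h x)) * g x \<partial>S)"
    using int[OF h] int[of "\<lambda>x. - h x"] h by simp
  also have "\<dots> = (\<integral>x. of_real (h x) * g x \<partial>S)"
    by (intro Bochner_Integration.integral_cong) (auto simp: max_def)
  finally show ?thesis .
qed

text \<open>
  Converse of \<open>represented_complex_integral\<close>: the complex measure is \<open>A \<mapsto> \<integral>\<^sub>A h dS\<close>.
\<close>

lemma represented_imp_complex_integral:
  assumes "represented N L"
  obtains \<mu> where "complex_measure N \<mu>" "\<And>g. bounded_measurable N g \<Longrightarrow> L g = complex_integral N \<mu> g"
proof -
  from assms obtain S h where S: "finite_measure S" "sets S = sets N" and h: "integrable S h"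
    and L: "\<And>g. bounded_measurable N g \<Longrightarrow> L g = (\<integral>x. h x * g x \<partial>S)"
    unfolding represented_def by blast
  define \<mu> where "\<mu> A = (\<integral>x\<in>A. h x \<partial>S)" for A
  have hA: "integrable S (\<lambda>x. indicator A x *\<^sub>R h x)" if "A \<in> sets N" for A
    using h that S(2) by (intro integrable_mult_indicator) auto
  have "(\<lambda>i. \<mu> (A i)) sums \<mu> (\<Union>i. A i)" if A: "range A \<subseteq> sets N" "disjoint_family A"
    for A :: "nat \<Rightarrow> _"
  proof -
    have sums: "(\<lambda>i. indicator (A i) x :: real) sums indicator (\<Union>i. A i) x" for x
      using A(2) by (intro indicator_sums) (auto simp: disjoint_family_on_def)
    have le1: "(\<Sum>i<n. indicator (A i) x :: real) \<le> 1" for x n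
    proof -
      have "(\<Sum>i<n. indicator (A i) x :: real) \<le> (\<Sum>i. indicator (A i) x)"
        using sums_summable[OF sums] by (intro sum_le_suminf) auto
      also have "\<dots> = indicator (\<Union>i. A i) x" by (rule sums_unique[OF sums, symmetric])
      also have "\<dots> \<le> 1" by (rule indicator_le_1)
      finally show ?thesis .
    qed
    have m: "(\<lambda>x. (\<Sum>i<n. indicator (A i) x) *\<^sub>R h x) \<in> borel_measurable S" for n
      using A(1) S(2) h by (intro borel_measurable_scaleR borel_measurable_sum borel_measurable_indicator) auto
    have "(\<lambda>n. \<integral>x. (\<Sum>i<n. indicator (A i) x) *\<^sub>R h x \<partial>S) \<longlonglongrightarrow> (\<integral>x. indicator (\<Union>i. A i) x *\<^sub>R h x \<partial>S)"
    proof (rule integral_dominated_convergence[where w = "\<lambda>x. norm (h x)"])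
      show "(\<lambda>x. indicator (\<Union>i. A i) x *\<^sub>R h x) \<in> borel_measurable S"
        using hA[of "\<Union>i. A i"] A(1) by auto
      show "AE x in S. (\<lambda>n. (\<Sum>i<n. indicator (A i) x) *\<^sub>R h x) \<longlonglongrightarrow> indicator (\<Union>i. A i) x *\<^sub>R h x"
        using sums unfolding sums_def by (intro AE_I2 tendsto_scaleR tendsto_const)
      show "AE x in S. norm ((\<Sum>i<n. indicator (A i) x) *\<^sub>R h x) \<le> norm (h x)" for n
        using le1 by (intro AE_I2) (simp add: mult_left_le_one_le sum_nonneg)
    qed (use m h in auto)
    moreover have "(\<integral>x. (\<Sum>i<n. indicator (A i) x) *\<^sub>R h x \<partial>S) = (\<Sum>i<n. \<mu> (A i))" for n
      unfolding \<mu>_def set_lebesgue_integral_def scaleR_left.sum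
      using A(1) by (intro Bochner_Integration.integral_sum hA) auto
    ultimately show ?thesis
      unfolding sums_def by (simp add: \<mu>_def set_lebesgue_integral_def)
  qed
  moreover have "\<mu> {} = 0" by (simp add: \<mu>_def set_lebesgue_integral_def)
  ultimately have "complex_measure N \<mu>"
    unfolding complex_measure_def by blast
  moreover have "L g = complex_integral N \<mu> g" if g: "bounded_measurable N g" for g
  proof -
    have r: "Re (\<mu> A) = (\<integral>x\<in>A. Re (h x) \<partial>S)" "Im (\<mu> A) = (\<integral>x\<in>A. Im (h x) \<partial>S)"
      if "A \<in> sets N" for A
      using hA[OF that] unfolding \<mu>_def set_lebesgue_integral_def by (simp_all flip: integral_Re integral_Im)
    have hh: "integrable S (\<lambda>x. Re (h x))" "integrable S (\<lambda>x. Im (h x))" using h by auto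
    have gm: "g \<in> borel_measurable S"
      using g S unfolding bounded_measurable_def by (simp cong: measurable_cong_sets)
    obtain C where C: "\<And>x. x \<in> space S \<Longrightarrow> norm (g x) \<le> C"
      using g sets_eq_imp_space_eq[OF S(2)] unfolding bounded_measurable_def by auto
    have int: "integrable S (\<lambda>x. of_real (k x) * g x)" if "integrable S k" for k :: "_ \<Rightarrow> real"
      using that gm C by (intro integrable_mult_bounded_measurable[where C = C]) auto
    have "complex_integral N \<mu> g = (\<integral>x. of_real (Re (h x)) * g x \<partial>S)
        + \<i> * (\<integral>x. of_real (Im (h x)) * g x \<partial>S)"
      unfolding complex_integral_def
      using signed_integral_density[OF S(2) hh(1) r(1) g] signed_integral_density[OF S(2) hh(2) r(2) g]
      by simp
    also have "\<dots> = (\<integral>x. of_real (Re (h x)) * g x + \<i> * (of_real (Im (h x)) * g x) \<partial>S)"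
      using int[OF hh(1)] int[OF hh(2)] by simp
    also have "\<dots> = (\<integral>x. h x * g x \<partial>S)"
      by (intro Bochner_Integration.integral_cong refl complex_split_mult)
    finally show ?thesis using L[OF g] by simp
  qed
  ultimately show ?thesis using that by blast
qed

section \<open>Differentiation under the integral sign\<close>

text \<open>
  The hypotheses on the kernel \<open>k\<close> are only required where the weight \<open>h\<close> does not vanish, so that \<open>h\<close>
  may carry the indicator of the domain of integration.
\<close>

lemma has_field_derivative_parametric_integral:
  fixes h :: "'b \<Rightarrow> complex" and k k' :: "'b \<Rightarrow> complex \<Rightarrow> complex"
  assumes U: "open U" "convex U" and z: "z0 \<in> U" "z1 \<in> U"
    and h: "integrable M h"
    and int: "integrable M (\<lambda>w. h w * k w z1)"
    and k: "\<And>w z. w \<in> space M \<Longrightarrow> h w \<noteq> 0 \<Longrightarrow> z \<in> U \<Longrightarrow> (k w has_field_derivative k' w z) (at z)"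
    and bound: "\<And>w z. w \<in> space M \<Longrightarrow> h w \<noteq> 0 \<Longrightarrow> z \<in> U \<Longrightarrow> norm (k' w z) \<le> C"
    and meas: "\<And>z. z \<in> U \<Longrightarrow> (\<lambda>w. h w * k w z) \<in> borel_measurable M"
      "(\<lambda>w. h w * k' w z0) \<in> borel_measurable M"
  shows "((\<lambda>z. \<integral>w. h w * k w z \<partial>M) has_field_derivative (\<integral>w. h w * k' w z0 \<partial>M)) (at z0)"
proof -
  have lip: "norm (h w * k w x - h w * k w y) \<le> norm (h w) * (C * norm (x - y))"
    if "w \<in> space M" "x \<in> U" "y \<in> U" for w x y
  proof (cases "h w = 0")
    case False
    have "norm (k w x - k w y) \<le> C * norm (x - y)"
      using that False by (intro field_differentiable_bound[OF U(2), where f' = "k' w"])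
         (auto intro: bound has_field_derivative_at_within[OF k])
    then show ?thesis by (simp add: norm_mult mult_left_mono flip: right_diff_distrib)
  qed simp
  have i: "integrable M (\<lambda>w. h w * k w z)" if "z \<in> U" for z
  proof -
    have "integrable M (\<lambda>w. h w * k w z - h w * k w z1)"
    proof (rule Bochner_Integration.integrable_bound)
      show "integrable M (\<lambda>w. of_real (C * norm (z - z1)) * h w)" using h by simp
      show "AE w in M. norm (h w * k w z - h w * k w z1) \<le> norm (of_real (C * norm (z - z1)) * h w)"
      proof (rule AE_I2)
        fix w assume w: "w \<in> space M"
        have "norm (h w * k w z - h w * k w z1) \<le> norm (h w) * (C * norm (z - z1))"
          by (rule lip[OF w that z(2)])
        also have "\<dots> \<le> norm (h w) * \<bar>C * norm (z - z1)\<bar>" by (intro mult_left_mono) auto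
        finally show "norm (h w * k w z - h w * k w z1) \<le> norm (of_real (C * norm (z - z1)) * h w)"
          by (simp add: norm_mult mult.commute abs_mult)
      qed
    qed (use meas(1)[OF that] meas(1)[OF z(2)] in measurable)
    from Bochner_Integration.integrable_add[OF this int] show ?thesis by simp
  qed
  have "((\<lambda>z. \<integral>w. h w * k w z \<partial>M) has_field_derivative (\<integral>w. h w * k' w z0 \<partial>M)) (at z0 within U)"
    unfolding has_field_derivative_iff tendsto_at_iff_sequentially
  proof (intro allI impI)
    fix X assume X: "\<forall>i. X i \<in> U - {z0}" "X \<longlonglongrightarrow> z0"
    have "(\<lambda>i. \<integral>w. (h w * k w (X i) - h w * k w z0) / (X i - z0) \<partial>M) \<longlonglongrightarrow> (\<integral>w. h w * k' w z0 \<partial>M)"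
    proof (rule integral_dominated_convergence[where w = "\<lambda>w. norm (h w) * C"])
      show "(\<lambda>w. (h w * k w (X i) - h w * k w z0) / (X i - z0)) \<in> borel_measurable M" for i
        using meas(1)[of "X i"] meas(1)[OF z(1)] X(1)
        by (intro borel_measurable_divide borel_measurable_diff borel_measurable_const) auto
      show "integrable M (\<lambda>w. norm (h w) * C)" using h by simp
      show "AE w in M. (\<lambda>i. (h w * k w (X i) - h w * k w z0) / (X i - z0)) \<longlonglongrightarrow> h w * k' w z0"
      proof (rule AE_I2)
        fix w assume w: "w \<in> space M"
        show "(\<lambda>i. (h w * k w (X i) - h w * k w z0) / (X i - z0)) \<longlonglongrightarrow> h w * k' w z0"
        proof (cases "h w = 0")
          case False
          have "((\<lambda>z. h w * k w z) has_field_derivative h w * k' w z0) (at z0 within U)"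
            by (rule has_field_derivative_at_within[OF DERIV_cmult[OF k[OF w False z(1)]]])
          then show ?thesis
            using X unfolding has_field_derivative_iff tendsto_at_iff_sequentially comp_def by blast
        qed simp
      qed
      show "AE w in M. norm ((h w * k w (X i) - h w * k w z0) / (X i - z0)) \<le> norm (h w) * C" for i
      proof (rule AE_I2)
        fix w assume w: "w \<in> space M"
        have Xi: "X i \<in> U" "X i \<noteq> z0" using X(1) by auto
        show "norm ((h w * k w (X i) - h w * k w z0) / (X i - z0)) \<le> norm (h w) * C"
          using lip[OF w Xi(1) z(1)] Xi(2) by (simp add: norm_divide divide_simps mult.assoc)
      qed
    qed (rule meas(2))
    moreover have "(\<integral>w. (h w * k w (X i) - h w * k w z0) / (X i - z0) \<partial>M)
       = ((\<integral>w. h w * k w (X i) \<partial>M) - (\<integral>w. h w * k w z0 \<partial>M)) / (X i - z0)" for i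
      using X(1) i z(1) by (simp add: integral_divide_zero)
    ultimately show "((\<lambda>y. ((\<integral>w. h w * k w y \<partial>M) - (\<integral>w. h w * k w z0 \<partial>M)) / (y - z0)) \<circ> X)
        \<longlonglongrightarrow> (\<integral>w. h w * k' w z0 \<partial>M)"
      by (simp only: comp_def)
  qed
  then show ?thesis by (simp only: at_within_open[OF z(1) U(1)])
qed

lemma eq_on_unit_disk_if_deriv_eq:
  assumes "\<And>z. z \<in> unit_disk \<Longrightarrow> (f has_field_derivative d z) (at z)"
    and "\<And>z. z \<in> unit_disk \<Longrightarrow> (g has_field_derivative d z) (at z)"
    and "f 0 = g 0" "z \<in> unit_disk"
  shows "f z = g z"
proof -
  have "\<exists>c. \<forall>z\<in>unit_disk. f z - g z = c"
  proof (rule has_field_derivative_zero_constant)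
    show "((\<lambda>z. f z - g z) has_field_derivative 0) (at x within unit_disk)" if "x \<in> unit_disk" for x
      using DERIV_diff[OF assms(1)[OF that] assms(2)[OF that]] by (simp add: has_field_derivative_at_within)
  qed simp
  then obtain c where c: "\<And>z. z \<in> unit_disk \<Longrightarrow> f z - g z = c" by blast
  from c[of 0] assms(3) have "c = 0" by simp
  with c[OF assms(4)] show ?thesis by simp
qed

section \<open>The transforms and their kernels\<close>

lemma space_circle_borel [simp]: "space circle_borel = sphere 0 1"
  by (simp add: circle_borel_def space_restrict_space)

lemma bounded_measurable_continuous_on:
  assumes "continuous_on (sphere 0 1) g"
  shows "bounded_measurable circle_borel g"
proof -
  have "bounded (g ` sphere 0 1)"
    using assms by (intro compact_imp_bounded compact_continuous_image) auto
  then show ?thesis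
    unfolding bounded_measurable_def bounded_iff circle_borel_def
    using assms by (auto intro: borel_measurable_continuous_on_restrict simp: space_restrict_space)
qed

lemma measurable_circle_borel_continuous:
  assumes "continuous_on (sphere 0 1) X" "\<And>x. x \<in> sphere 0 1 \<Longrightarrow> X x \<in> sphere 0 1"
  shows "X \<in> measurable circle_borel circle_borel"
  unfolding circle_borel_def
  using assms by (intro measurable_restrict_space2 borel_measurable_continuous_on_restrict)
    (auto simp: space_restrict_space)

lemma Re_one_minus_pos: "norm (v :: complex) < 1 \<Longrightarrow> 0 < Re (1 - v)"
  using complex_Re_le_cmod[of v] by simp

lemma one_minus_notin_nonpos_Reals: "norm (v :: complex) < 1 \<Longrightarrow> 1 - v \<notin> \<real>\<^sub>\<le>\<^sub>0"
  using Re_one_minus_pos[of v] by (auto simp: complex_nonpos_Reals_iff)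

text \<open>
  The two arguments lie strictly between \<open>-\<pi>/2\<close> and \<open>\<pi>/2\<close>, so their difference is a principal one.
\<close>

lemma Ln_divide_right_half_plane:
  assumes "0 < Re a" "0 < Re b"
  shows "Ln (a / b) = Ln a - Ln b"
proof -
  have ne: "a \<noteq> 0" "b \<noteq> 0" using assms by auto
  have im: "\<bar>Im (Ln a)\<bar> < pi / 2" "\<bar>Im (Ln b)\<bar> < pi / 2"
    using Re_Ln_pos_lt[OF ne(1)] Re_Ln_pos_lt[OF ne(2)] assms by blast+
  have "a / b = exp (Ln a - Ln b)" using ne by (simp add: exp_diff)
  then show ?thesis using im by (simp only:) (rule Ln_exp, auto)
qed

lemma Ln_inverse_one_minus:
  fixes v :: complex
  assumes "norm v < 1"
  shows "Ln (1 / (1 - v)) = - Ln (1 - v)"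
  using Ln_divide_right_half_plane[of 1, OF _ Re_one_minus_pos[OF assms]] by simp

lemma norm_circle_mult_less: "\<xi> \<in> sphere 0 1 \<Longrightarrow> z \<in> unit_disk \<Longrightarrow> norm (\<xi> * z) < 1"
  and norm_cnj_circle_mult_less: "\<xi> \<in> sphere 0 1 \<Longrightarrow> z \<in> unit_disk \<Longrightarrow> norm (cnj \<xi> * z) < 1"
  by (simp_all add: norm_mult)

lemma J_kernel_eq:
  assumes "\<xi> \<in> sphere 0 1" "z \<in> unit_disk"
  shows "ln ((1 - \<xi> * z) / (1 - cnj \<xi> * z)) = ln (1 - \<xi> * z) - ln (1 - cnj \<xi> * z)"
  using assms by (intro Ln_divide_right_half_plane Re_one_minus_pos)
    (simp_all add: norm_mult)

lemma continuous_on_Ln_kernel: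
  assumes "z \<in> unit_disk"
  shows "continuous_on (sphere 0 1) (\<lambda>\<xi>. ln (1 - cnj \<xi> * z))" "continuous_on (sphere 0 1) (\<lambda>\<xi>. ln (1 - \<xi> * z))"
  using assms by (auto intro!: continuous_intros one_minus_notin_nonpos_Reals simp: norm_mult)

lemma bounded_measurable_J_kernel:
  assumes "z \<in> unit_disk"
  shows "bounded_measurable circle_borel (\<lambda>\<xi>. ln ((1 - \<xi> * z) / (1 - cnj \<xi> * z)))"
proof (rule bounded_measurable_continuous_on)
  have "continuous_on (sphere 0 1) (\<lambda>\<xi>. ln (1 - \<xi> * z) - ln (1 - cnj \<xi> * z))"
    using continuous_on_Ln_kernel[OF assms] by (intro continuous_on_diff)
  then show "continuous_on (sphere 0 1) (\<lambda>\<xi>. ln ((1 - \<xi> * z) / (1 - cnj \<xi> * z)))"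
    by (rule continuous_on_eq) (use J_kernel_eq[OF _ assms] in simp)
qed

lemma circle_neq_disk: "\<xi> \<in> sphere 0 1 \<Longrightarrow> z \<in> unit_disk \<Longrightarrow> \<xi> \<noteq> z"
  and circle_mult_neq_1: "\<xi> \<in> sphere 0 1 \<Longrightarrow> z \<in> unit_disk \<Longrightarrow> \<xi> * z \<noteq> 1"
  using norm_circle_mult_less by fastforce+

lemma bounded_measurable_K_kernel:
  assumes "z \<in> unit_disk"
  shows "bounded_measurable circle_borel (\<lambda>\<xi>. 1 / (\<xi> - z) - \<xi> / (1 - \<xi> * z))"
  using circle_neq_disk[OF _ assms] circle_mult_neq_1[OF _ assms]
  by (intro bounded_measurable_continuous_on continuous_intros) auto

lemma J_kernel_derivative:
  assumes "\<xi> \<in> sphere 0 1" "z \<in> unit_disk"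
  shows "((\<lambda>z. ln ((1 - \<xi> * z) / (1 - cnj \<xi> * z))) has_field_derivative
            1 / (\<xi> - z) - \<xi> / (1 - \<xi> * z)) (at z)"
proof (rule has_field_derivative_transform_within_open)
  have c: "cnj \<xi> * \<xi> = 1" "\<xi> \<noteq> 0"
    using assms(1) by (auto simp: complex_norm_square[symmetric] mult.commute[of "cnj \<xi>"])
  have "\<xi> * (1 - cnj \<xi> * z) = \<xi> - z" using c by (simp add: algebra_simps)
  then have "cnj \<xi> / (1 - cnj \<xi> * z) = 1 / (\<xi> - z)"
    using c by (metis mult.commute mult_divide_mult_cancel_left)
  moreover have "((\<lambda>z. ln (1 - \<xi> * z) - ln (1 - cnj \<xi> * z)) has_field_derivative
            - \<xi> / (1 - \<xi> * z) - - cnj \<xi> / (1 - cnj \<xi> * z)) (at z)"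
    using one_minus_notin_nonpos_Reals[OF norm_circle_mult_less[OF assms]]
      one_minus_notin_nonpos_Reals[OF norm_cnj_circle_mult_less[OF assms]]
    by (auto intro!: derivative_eq_intros simp: divide_simps)
  ultimately show "((\<lambda>z. ln (1 - \<xi> * z) - ln (1 - cnj \<xi> * z)) has_field_derivative
            1 / (\<xi> - z) - \<xi> / (1 - \<xi> * z)) (at z)" by simp
  show "open unit_disk" "z \<in> unit_disk" using assms by auto
  show "ln (1 - \<xi> * w) - ln (1 - cnj \<xi> * w) = ln ((1 - \<xi> * w) / (1 - cnj \<xi> * w))"
    if "w \<in> unit_disk" for w
    by (rule J_kernel_eq[OF assms(1) that, symmetric])
qed

lemma K_kernel_bound:
  fixes \<xi> z :: complex
  assumes "\<xi> \<in> sphere 0 1" "norm z < r" "r < 1"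
  shows "norm (1 / (\<xi> - z) - \<xi> / (1 - \<xi> * z)) \<le> 2 / (1 - r)"
proof -
  have n: "norm \<xi> = 1" using assms(1) by simp
  have "1 - r \<le> norm (\<xi> - z)" using norm_triangle_ineq2[of \<xi> z] assms n by linarith
  moreover have "1 - r \<le> norm (1 - \<xi> * z)"
    using norm_triangle_ineq2[of 1 "\<xi> * z"] assms n by (simp add: norm_mult)
  ultimately have "1 / norm (\<xi> - z) \<le> 1 / (1 - r)" "1 / norm (1 - \<xi> * z) \<le> 1 / (1 - r)"
    using assms(3) by (auto intro!: divide_left_mono mult_pos_pos)
  moreover have "norm (1 / (\<xi> - z) - \<xi> / (1 - \<xi> * z)) \<le> 1 / norm (\<xi> - z) + 1 / norm (1 - \<xi> * z)"
    using norm_triangle_ineq4[of "1 / (\<xi> - z)" "\<xi> / (1 - \<xi> * z)"] n by (simp add: norm_divide)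
  ultimately show ?thesis by simp
qed

lemma J_transform_derivative:
  assumes \<mu>: "\<mu> \<in> circle_measures" and z: "z \<in> unit_disk"
  shows "(J_transform \<mu> has_field_derivative K_transform \<mu> z) (at z)"
proof -
  let ?k = "\<lambda>\<xi> z. ln ((1 - \<xi> * z) / (1 - cnj \<xi> * z))"
  let ?k' = "\<lambda>\<xi> z. 1 / (\<xi> - z) - \<xi> / (1 - \<xi> * z)"
  have "represented circle_borel (complex_integral circle_borel \<mu>)"
    using \<mu> unfolding circle_measures_def by (auto intro: represented_complex_integral)
  then obtain S h where S: "finite_measure S" "sets S = sets circle_borel" and h: "integrable S h"
    and L: "\<And>g. bounded_measurable circle_borel g \<Longrightarrow>
              complex_integral circle_borel \<mu> g = (\<integral>x. h x * g x \<partial>S)"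
    unfolding represented_def by blast
  have sp: "space S = sphere 0 1" using sets_eq_imp_space_eq[OF S(2)] by simp
  have meas: "g \<in> borel_measurable S" if "bounded_measurable circle_borel g" for g
    using that S(2) unfolding bounded_measurable_def by (simp cong: measurable_cong_sets)
  obtain r where r: "norm z < r" "r < 1" using z dense[of "norm z" 1] by auto
  then have r0: "0 < r" using norm_ge_zero[of z] by linarith
  have sub: "ball 0 r \<subseteq> unit_disk" using r by auto
  have "((\<lambda>z. \<integral>\<xi>. h \<xi> * ?k \<xi> z \<partial>S) has_field_derivative (\<integral>\<xi>. h \<xi> * ?k' \<xi> z \<partial>S)) (at z)"
  proof (rule has_field_derivative_parametric_integral[where U = "ball 0 r" and ?z1.0 = 0 and C = "2 / (1 - r)"])
    show "(?k \<xi> has_field_derivative ?k' \<xi> w) (at w)"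
      if "\<xi> \<in> space S" "h \<xi> \<noteq> 0" "w \<in> ball 0 r" for \<xi> w
      using that sp sub by (intro J_kernel_derivative) auto
    show "norm (?k' \<xi> w) \<le> 2 / (1 - r)"
      if "\<xi> \<in> space S" "h \<xi> \<noteq> 0" "w \<in> ball 0 r" for \<xi> w
      using that sp r by (intro K_kernel_bound) auto
    show "(\<lambda>\<xi>. h \<xi> * ?k \<xi> w) \<in> borel_measurable S" if "w \<in> ball 0 r" for w
      using meas[OF bounded_measurable_J_kernel] that sub h by (intro borel_measurable_times) auto
    show "(\<lambda>\<xi>. h \<xi> * ?k' \<xi> z) \<in> borel_measurable S"
      using meas[OF bounded_measurable_K_kernel[OF z]] h by (intro borel_measurable_times) auto
  qed (use r r0 h in auto)
  moreover have "J_transform \<mu> w = (\<integral>\<xi>. h \<xi> * ?k \<xi> w \<partial>S)" if "w \<in> unit_disk" for w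
    unfolding J_transform_def by (rule L[OF bounded_measurable_J_kernel[OF that]])
  moreover have "K_transform \<mu> z = (\<integral>\<xi>. h \<xi> * ?k' \<xi> z \<partial>S)"
    unfolding K_transform_def by (rule L[OF bounded_measurable_K_kernel[OF z]])
  ultimately show ?thesis
    using z by (auto intro: has_field_derivative_transform_within_open[of _ _ _ unit_disk])
qed

lemma J_transform_0: "J_transform \<mu> 0 = 0"
  by (simp add: J_transform_def complex_integral_def signed_integral_def)

lemma J_transform_iff_derivative:
  assumes \<mu>: "\<mu> \<in> circle_measures" and f: "f analytic_on unit_disk"
  shows "(\<forall>z\<in>unit_disk. f z - f 0 = J_transform \<mu> z) \<longleftrightarrow>
         (\<forall>z\<in>unit_disk. deriv f z = K_transform \<mu> z)"
proof
  assume J: "\<forall>z\<in>unit_disk. f z - f 0 = J_transform \<mu> z"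
  show "\<forall>z\<in>unit_disk. deriv f z = K_transform \<mu> z"
  proof
    fix z assume z: "z \<in> unit_disk"
    have "((\<lambda>z. J_transform \<mu> z + f 0) has_field_derivative K_transform \<mu> z + 0) (at z)"
      by (intro DERIV_add J_transform_derivative[OF \<mu> z] DERIV_const)
    then have "(f has_field_derivative K_transform \<mu> z) (at z)"
      unfolding add_0_right
    proof (rule has_field_derivative_transform_within_open[OF _ open_ball z])
      show "J_transform \<mu> w + f 0 = f w" if "w \<in> unit_disk" for w
        by (simp only: bspec[OF J that, symmetric] diff_add_cancel)
    qed
    then show "deriv f z = K_transform \<mu> z" by (rule DERIV_imp_deriv)
  qed
next
  assume K: "\<forall>z\<in>unit_disk. deriv f z = K_transform \<mu> z"
  show "\<forall>z\<in>unit_disk. f z - f 0 = J_transform \<mu> z"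
  proof
    fix z assume z: "z \<in> unit_disk"
    show "f z - f 0 = J_transform \<mu> z"
    proof (rule eq_on_unit_disk_if_deriv_eq[OF _ J_transform_derivative[OF \<mu>] _ z])
      fix w assume w: "w \<in> unit_disk"
      have "(f has_field_derivative deriv f w) (at w)"
        using f w by (intro holomorphic_derivI[of _ unit_disk]) (auto intro: analytic_imp_holomorphic)
      then have "((\<lambda>z. f z - f 0) has_field_derivative deriv f w - 0) (at w)"
        by (intro DERIV_diff DERIV_const)
      then show "((\<lambda>z. f z - f 0) has_field_derivative K_transform \<mu> w) (at w)"
        using K w by simp
    qed (simp_all add: J_transform_0)
  qed
qed

lemma J_family_analytic:
  assumes "f \<in> J_family"
  shows "f analytic_on unit_disk"
proof -
  from assms obtain \<mu> where \<mu>: "\<mu> \<in> circle_measures" "\<And>z. z \<in> unit_disk \<Longrightarrow> f z = J_transform \<mu> z"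
    unfolding J_family_def by blast
  have "J_transform \<mu> holomorphic_on unit_disk"
    using J_transform_derivative[OF \<mu>(1)] unfolding holomorphic_on_open[OF open_ball] by blast
  then have "f holomorphic_on unit_disk"
    by (rule holomorphic_transform) (simp add: \<mu>(2))
  then show ?thesis by (simp add: analytic_on_open)
qed

lemma J_family_representation:
  assumes "f \<in> J_family"
  obtains S h where "finite_measure S" "sets S = sets circle_borel" "integrable S h"
    "\<And>z. z \<in> unit_disk \<Longrightarrow> f z = (\<integral>\<xi>. h \<xi> * ln ((1 - \<xi> * z) / (1 - cnj \<xi> * z)) \<partial>S)"
proof -
  from assms obtain \<mu> where \<mu>: "\<mu> \<in> circle_measures" "\<And>z. z \<in> unit_disk \<Longrightarrow> f z = J_transform \<mu> z"
    unfolding J_family_def by blast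
  have "represented circle_borel (complex_integral circle_borel \<mu>)"
    using \<mu>(1) unfolding circle_measures_def by (auto intro: represented_complex_integral)
  then obtain S h where S: "finite_measure S" "sets S = sets circle_borel" and h: "integrable S h"
    and L: "\<And>g. bounded_measurable circle_borel g \<Longrightarrow>
              complex_integral circle_borel \<mu> g = (\<integral>x. h x * g x \<partial>S)"
    unfolding represented_def by blast
  show thesis
    using that[OF S h] \<mu>(2) L[OF bounded_measurable_J_kernel] by (simp add: J_transform_def)
qed

lemma J_familyI:
  assumes "represented circle_borel L"
    and "\<And>z. z \<in> unit_disk \<Longrightarrow> f z = L (\<lambda>\<xi>. ln ((1 - \<xi> * z) / (1 - cnj \<xi> * z)))"
  shows "f \<in> J_family"
proof -
  obtain \<mu> where "complex_measure circle_borel \<mu>"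
    "\<And>g. bounded_measurable circle_borel g \<Longrightarrow> L g = complex_integral circle_borel \<mu> g"
    using represented_imp_complex_integral[OF assms(1)] by blast
  then show ?thesis
    using assms(2) bounded_measurable_J_kernel
    unfolding J_family_def circle_measures_def J_transform_def by auto
qed

section \<open>Logarithmic kernels\<close>

text \<open>
  The term \<open>ln (1 - \<xi>z)\<close> of the kernel is pushed forward under conjugation. The resulting functional
  serves both the case \<open>\<alpha> = 0\<close> and, after convolution, the case \<open>\<alpha> > 0\<close>.
\<close>

lemma J_family_log_representation:
  assumes "f \<in> J_family"
  obtains L where "represented circle_borel L"
    "\<And>z. z \<in> unit_disk \<Longrightarrow> f z = L (\<lambda>\<xi>. ln (1 / (1 - cnj \<xi> * z)))"
proof -
  obtain S h where S: "finite_measure S" "sets S = sets circle_borel" and h: "integrable S h"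
    and f: "\<And>z. z \<in> unit_disk \<Longrightarrow> f z = (\<integral>\<xi>. h \<xi> * ln ((1 - \<xi> * z) / (1 - cnj \<xi> * z)) \<partial>S)"
    using J_family_representation[OF assms] by blast
  have sp: "space S = sphere 0 1" using sets_eq_imp_space_eq[OF S(2)] by simp
  define L where "L g = (\<integral>\<xi>. h \<xi> * g \<xi> \<partial>S) + - 1 * (\<integral>\<xi>. h \<xi> * g (cnj \<xi>) \<partial>S)" for g
  have "(\<lambda>x. x) \<in> measurable S circle_borel" "cnj \<in> measurable S circle_borel"
    using measurable_circle_borel_continuous[of cnj] S(2)
    by (auto intro!: continuous_intros cong: measurable_cong_sets)
  then have "represented circle_borel L"
    unfolding L_def
    by (intro represented_add represented_scale represented_pushforward[OF h])
  moreover have "f z = L (\<lambda>\<xi>. ln (1 / (1 - cnj \<xi> * z)))" if z: "z \<in> unit_disk" for z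
  proof -
    have m: "(\<lambda>\<xi>. ln (1 - cnj \<xi> * z)) \<in> borel_measurable S" "(\<lambda>\<xi>. ln (1 - \<xi> * z)) \<in> borel_measurable S"
      and b: "\<exists>C. \<forall>x\<in>space S. norm (ln (1 - cnj x * z)) \<le> C" "\<exists>C. \<forall>x\<in>space S. norm (ln (1 - x * z)) \<le> C"
      using bounded_measurable_continuous_on[OF continuous_on_Ln_kernel(1)[OF z]]
        bounded_measurable_continuous_on[OF continuous_on_Ln_kernel(2)[OF z]] S(2) sp
      unfolding bounded_measurable_def by (simp_all cong: measurable_cong_sets)
    have i: "integrable S (\<lambda>\<xi>. h \<xi> * ln (1 - cnj \<xi> * z))" "integrable S (\<lambda>\<xi>. h \<xi> * ln (1 - \<xi> * z))"
      using m b by (auto intro: integrable_mult_bounded_measurable[OF h])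
    have "f z = (\<integral>\<xi>. h \<xi> * ln (1 - \<xi> * z) - h \<xi> * ln (1 - cnj \<xi> * z) \<partial>S)"
      unfolding f[OF z] using J_kernel_eq[OF _ z] sp
      by (intro Bochner_Integration.integral_cong) (simp_all add: right_diff_distrib)
    also have "\<dots> = (\<integral>\<xi>. h \<xi> * ln (1 - \<xi> * z) \<partial>S) - (\<integral>\<xi>. h \<xi> * ln (1 - cnj \<xi> * z) \<partial>S)"
      using i by simp
    also have "(\<integral>\<xi>. h \<xi> * ln (1 - \<xi> * z) \<partial>S) = - (\<integral>\<xi>. h \<xi> * ln (1 / (1 - cnj (cnj \<xi>) * z)) \<partial>S)"
      using sp norm_circle_mult_less[OF _ z]
      unfolding Bochner_Integration.integral_minus[symmetric]
      by (intro Bochner_Integration.integral_cong) (simp_all add: Ln_inverse_one_minus)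
    also have "(\<integral>\<xi>. h \<xi> * ln (1 - cnj \<xi> * z) \<partial>S) = - (\<integral>\<xi>. h \<xi> * ln (1 / (1 - cnj \<xi> * z)) \<partial>S)"
      using sp norm_cnj_circle_mult_less[OF _ z]
      unfolding Bochner_Integration.integral_minus[symmetric]
      by (intro Bochner_Integration.integral_cong) (simp_all add: Ln_inverse_one_minus)
    finally show ?thesis unfolding L_def by simp
  qed
  ultimately show thesis using that by blast
qed

lemma bounded_measurable_log_kernel:
  assumes "z \<in> unit_disk"
  shows "bounded_measurable circle_borel (\<lambda>\<xi>. ln (1 / (1 - cnj \<xi> * z)))"
proof (rule bounded_measurable_continuous_on)
  have "continuous_on (sphere 0 1) (\<lambda>\<xi>. - ln (1 - cnj \<xi> * z))"
    using continuous_on_Ln_kernel(1)[OF assms] by (rule continuous_on_minus)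
  then show "continuous_on (sphere 0 1) (\<lambda>\<xi>. ln (1 / (1 - cnj \<xi> * z)))"
    by (rule continuous_on_eq)
       (use norm_cnj_circle_mult_less[OF _ assms] in \<open>simp add: Ln_inverse_one_minus\<close>)
qed

lemma J_family_subset_F_0: "J_family \<subseteq> F_family 0"
proof
  fix f assume f: "f \<in> J_family"
  then obtain L where L: "represented circle_borel L"
    "\<And>z. z \<in> unit_disk \<Longrightarrow> f z = L (\<lambda>\<xi>. ln (1 / (1 - cnj \<xi> * z)))"
    using J_family_log_representation by blast
  obtain \<mu> where \<mu>: "complex_measure circle_borel \<mu>"
    "\<And>g. bounded_measurable circle_borel g \<Longrightarrow> L g = complex_integral circle_borel \<mu> g"
    using represented_imp_complex_integral[OF L(1)] by blast
  have f0: "f 0 = 0" using f J_transform_0 unfolding J_family_def by auto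
  have eq: "f z = f 0 + complex_integral circle_borel \<mu> (\<lambda>\<xi>. ln (1 / (1 - cnj \<xi> * z)))"
    if "z \<in> unit_disk" for z
    unfolding f0 add_0 using L(2)[OF that] \<mu>(2)[OF bounded_measurable_log_kernel[OF that]] by (rule trans)
  have "\<mu> \<in> circle_measures" using \<mu>(1) by (simp add: circle_measures_def)
  then show "f \<in> F_family 0"
    unfolding F_family_def mem_Collect_eq if_P[OF refl] using J_family_analytic[OF f] eq by blast
qed

section \<open>The logarithm as an average of powers\<close>

text \<open>
  On the unit circle this is \<open>(P\<^sub>t(w) - 1)/t\<close> for the Poisson kernel \<open>P\<^sub>t(w) = (1 - t\<^sup>2)/|w - t|\<^sup>2\<close>.
\<close>

definition poisson_quotient :: "real \<Rightarrow> complex \<Rightarrow> real" where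
  "poisson_quotient t w = 2 * Re (1 / (w - of_real t))"

lemma circle_minus_real_neq_0:
  assumes "norm (w :: complex) = 1" "0 < t" "t < 1"
  shows "w - of_real t \<noteq> 0" "1 - of_real t * w \<noteq> 0"
proof -
  have "norm (complex_of_real t) < 1" "norm (complex_of_real t * w) < 1" using assms by (simp_all add: norm_mult)
  then show "w - of_real t \<noteq> 0" "1 - of_real t * w \<noteq> 0" using assms(1) by auto
qed

lemma poisson_quotient_eq:
  assumes "norm w = 1" "0 < t" "t < 1"
  shows "of_real (poisson_quotient t w) = 1 / (w - of_real t) + w / (1 - of_real t * w)"
proof -
  have "w * cnj w = 1" using assms(1) complex_norm_square[of w] by simp
  then have "w * (cnj w - of_real t) = 1 - of_real t * w" by (simp add: algebra_simps)
  moreover have "w \<noteq> 0" using assms(1) by auto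
  ultimately have "w / (1 - of_real t * w) = 1 / (cnj w - of_real t)"
    by (metis mult_divide_mult_cancel_left mult.right_neutral)
  also have "\<dots> = cnj (1 / (w - of_real t))" by simp
  finally show ?thesis
    unfolding poisson_quotient_def using complex_add_cnj[of "1 / (w - of_real t)"] by simp
qed

text \<open>
  With \<open>P = 1 + t q \<ge> 0\<close> the Poisson kernel, the claim reads \<open>|q| \<le> 4 (P + 1)\<close>. Its right side has mean 8
  on the circle, whatever \<open>t\<close> is.
\<close>

lemma abs_poisson_quotient_le:
  assumes "norm w = 1" "0 < t" "t < 1"
  shows "\<bar>poisson_quotient t w\<bar> \<le> 4 * (2 + t * poisson_quotient t w)"
proof -
  define d where "d = w - of_real t"
  have d: "d \<noteq> 0" using circle_minus_real_neq_0[OF assms] unfolding d_def by simp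
  have q: "poisson_quotient t w = 2 * Re d / (norm d)\<^sup>2"
    unfolding poisson_quotient_def d_def[symmetric]
    by (simp add: Re_divide cmod_power2 )
  have "(norm d)\<^sup>2 + 2 * t * Re d = 1 - t\<^sup>2"
  proof -
    have "(Re w)\<^sup>2 + (Im w)\<^sup>2 = 1" using assms(1) cmod_power2[of w] by simp
    then show ?thesis unfolding cmod_power2 d_def by (simp add: power2_eq_square algebra_simps)
  qed
  moreover have "0 \<le> 1 - t\<^sup>2" using assms by (simp add: power_le_one)
  ultimately have "0 \<le> ((norm d)\<^sup>2 + 2 * t * Re d) / (norm d)\<^sup>2" by simp
  then have pos: "0 \<le> 1 + t * poisson_quotient t w"
    unfolding q using d by (simp add: add_divide_distrib mult.assoc mult.left_commute)
  show ?thesis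
  proof (cases "t \<le> 1 / 2")
    case True
    have "1 / 2 \<le> norm d"
      using norm_triangle_ineq2[of w "of_real t"] assms True unfolding d_def by simp
    then have "norm (1 / d) \<le> 2" by (simp add: norm_divide divide_simps d)
    then have "\<bar>poisson_quotient t w\<bar> \<le> 4"
      unfolding poisson_quotient_def d_def[symmetric] using abs_Re_le_cmod[of "1 / d"] by simp
    then show ?thesis using pos by simp
  next
    case False
    then have "\<bar>poisson_quotient t w\<bar> \<le> 2 * (t * \<bar>poisson_quotient t w\<bar>)"
      using mult_right_mono[of "1 / 2" t "\<bar>poisson_quotient t w\<bar>"] by simp
    also have "\<dots> = 2 * \<bar>t * poisson_quotient t w\<bar>" using assms(2) by (simp add: abs_mult)
    also have "\<dots> \<le> 4 * (2 + t * poisson_quotient t w)"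
      using pos by (cases "0 \<le> t * poisson_quotient t w") simp_all
    finally show ?thesis .
  qed
qed

text \<open>
  The unit circle parametrised by \<open>[0,1]\<close> with total mass 1.
\<close>

abbreviation unit_turn :: "real \<Rightarrow> complex" where
  "unit_turn x \<equiv> cis (2 * pi * x)"

lemma continuous_on_poisson_quotient:
  assumes "0 < t" "t < 1"
  shows "continuous_on A (\<lambda>x. poisson_quotient t (unit_turn x))"
  unfolding poisson_quotient_def
  using circle_minus_real_neq_0(1)[OF norm_cis assms] by (intro continuous_intros) auto

text \<open>
  On the circle the density times \<open>dw/w\<close> is \<open>(1/t) (1/(w - t) - 1/w) dw + dw/(1 - tw)\<close>, and the last
  summand does not contribute because it is holomorphic in the closed disk.
\<close>

lemma has_integral_poisson_quotient:
  assumes G: "G holomorphic_on cball 0 1" and t: "0 < t" "t < 1"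
  shows "((\<lambda>x. of_real (poisson_quotient t (unit_turn x)) * G (unit_turn x)) has_integral
            (G (of_real t) - G 0) / of_real t) {0..1}"
proof -
  have ne: "1 - of_real t * u \<noteq> 0" if "u \<in> cball 0 1" for u :: complex
  proof -
    have "norm (of_real t * u) \<le> t * 1" using that t by (simp add: norm_mult)
    then show ?thesis using t by auto
  qed
  have A: "((\<lambda>u. G u / (u - of_real t)) has_contour_integral 2 * of_real pi * \<i> * G (of_real t)) (circlepath 0 1)"
    using t by (intro Cauchy_integral_circlepath_simple G) auto
  have B: "((\<lambda>u. G u / (u - 0)) has_contour_integral 2 * of_real pi * \<i> * G 0) (circlepath 0 1)"
    by (intro Cauchy_integral_circlepath_simple G) auto
  have C: "((\<lambda>u. (u * G u / (1 - of_real t * u)) / (u - 0)) has_contour_integral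
      2 * of_real pi * \<i> * (0 * G 0 / (1 - of_real t * 0))) (circlepath 0 1)"
    using ne by (intro Cauchy_integral_circlepath_simple holomorphic_intros G) auto
  define F where "F u = 1 / of_real t * (G u / (u - of_real t) - G u / (u - 0))
                         + (u * G u / (1 - of_real t * u)) / (u - 0)" for u
  have "(F has_contour_integral 1 / of_real t * (2 * of_real pi * \<i> * G (of_real t) - 2 * of_real pi * \<i> * G 0)
      + 2 * of_real pi * \<i> * (0 * G 0 / (1 - of_real t * 0))) (circlepath 0 1)"
    unfolding F_def
    by (intro has_contour_integral_add has_contour_integral_lmul has_contour_integral_diff A B C)
  then have "((\<lambda>x. 1 / (2 * of_real pi * \<i>) * (F (circlepath 0 1 x) * vector_derivative (circlepath 0 1) (at x within {0..1})))
     has_integral 1 / (2 * of_real pi * \<i>) * (1 / of_real t * (2 * of_real pi * \<i> * G (of_real t) - 2 * of_real pi * \<i> * G 0)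
      + 2 * of_real pi * \<i> * (0 * G 0 / (1 - of_real t * 0)))) {0..1}"
    unfolding has_contour_integral_def by (rule has_integral_mult_right)
  also have "1 / (2 * of_real pi * \<i>) * (1 / of_real t * (2 * of_real pi * \<i> * G (of_real t) - 2 * of_real pi * \<i> * G 0)
      + 2 * of_real pi * \<i> * (0 * G 0 / (1 - of_real t * 0))) = (G (of_real t) - G 0) / of_real t"
    using t by (simp add: field_simps)
  finally have "((\<lambda>x. 1 / (2 * of_real pi * \<i>) * (F (circlepath 0 1 x) * vector_derivative (circlepath 0 1) (at x within {0..1})))
     has_integral (G (of_real t) - G 0) / of_real t) {0..1}" .
  then show ?thesis
  proof (rule has_integral_eq[rotated])
    fix x :: real assume x: "x \<in> {0..1}"
    define w where "w = unit_turn x"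
    have w: "norm w = 1" "w \<noteq> 0" unfolding w_def by auto
    have e: "exp (2 * of_real pi * \<i> * of_real x) = w"
      unfolding w_def cis_conv_exp by (simp add: mult_ac)
    have cp: "circlepath 0 1 x = w" by (simp add: circlepath e)
    have vd: "vector_derivative (circlepath 0 1) (at x within {0..1}) = 2 * of_real pi * \<i> * w"
      using vector_derivative_circlepath01[of x 0 1] x e by simp
    have "1 / (2 * of_real pi * \<i>) * (F (circlepath 0 1 x) * vector_derivative (circlepath 0 1) (at x within {0..1}))
        = w * F w"
      unfolding cp vd by (simp add: field_simps)
    also have "\<dots> = (1 / (w - of_real t) + w / (1 - of_real t * w)) * G w"
    proof -
      have n: "w - of_real t \<noteq> 0" "1 - of_real t * w \<noteq> 0" "of_real t \<noteq> (0 :: complex)"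
        using circle_minus_real_neq_0[OF w(1) t] t by auto
      have "w * F w = G w * ((1 / of_real t) * (w / (w - of_real t) - 1) + w / (1 - of_real t * w))"
      proof -
        have "w * (1 / of_real t * (G w / (w - of_real t) - G w / (w - 0)))
            = 1 / of_real t * (w * (G w / (w - of_real t)) - G w)"
          using w(2) by (simp add: right_diff_distrib)
        moreover have "w * (w * G w / (1 - of_real t * w) / (w - 0)) = w * G w / (1 - of_real t * w)"
          using w(2) by simp
        ultimately have "w * F w = 1 / of_real t * (w * (G w / (w - of_real t)) - G w) + w * G w / (1 - of_real t * w)"
          unfolding F_def distrib_left by (simp only:)
        then show ?thesis by (simp add: right_diff_distrib distrib_left mult_ac)
      qed
      also have "(1 / of_real t) * (w / (w - of_real t) - 1) = 1 / (w - of_real t)"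
        using n by (simp add: divide_simps)
      finally show ?thesis by (simp only: mult.commute)
    qed
    also have "\<dots> = of_real (poisson_quotient t w) * G w"
      by (simp only: poisson_quotient_eq[OF w(1) t])
    finally show "1 / (2 * of_real pi * \<i>) * (F (circlepath 0 1 x) * vector_derivative (circlepath 0 1) (at x within {0..1}))
        = of_real (poisson_quotient t (unit_turn x)) * G (unit_turn x)"
      unfolding w_def .
  qed
qed

lemma integral_poisson_quotient:
  assumes G: "G holomorphic_on cball 0 1" and t: "0 < t" "t < 1"
  shows "(\<integral>x. of_real (indicator {0..1} x * poisson_quotient t (unit_turn x)) * G (unit_turn x) \<partial>lborel)
       = (G (of_real t) - G 0) / of_real t"
proof -
  have "continuous_on {0..1} (\<lambda>x. G (unit_turn x))"
    by (rule continuous_on_compose2[OF holomorphic_on_imp_continuous_on[OF G]])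
       (auto intro!: continuous_intros)
  then have "set_integrable lborel {0..1} (\<lambda>x. of_real (poisson_quotient t (unit_turn x)) * G (unit_turn x))"
    by (intro borel_integrable_atLeastAtMost' continuous_intros continuous_on_poisson_quotient t)
  from set_borel_integral_eq_integral(2)[OF this]
  have "(LINT x:{0..1}|lborel. of_real (poisson_quotient t (unit_turn x)) * G (unit_turn x))
      = (G (of_real t) - G 0) / of_real t"
    using integral_unique[OF has_integral_poisson_quotient[OF G t]] by simp
  then show ?thesis
    by (simp add: set_lebesgue_integral_def scaleR_conv_of_real mult.assoc)
qed

lemma integral_abs_poisson_quotient_le:
  assumes t: "0 < t" "t < 1"
  shows "integrable lborel (\<lambda>x. indicator {0..1} x * poisson_quotient t (unit_turn x))"
    and "(\<integral>x. \<bar>indicator {0..1} x * poisson_quotient t (unit_turn x)\<bar> \<partial>lborel) \<le> 8"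
proof -
  let ?q = "\<lambda>x. indicator {0..1} x * poisson_quotient t (unit_turn x)"
  have "set_integrable lborel {0..1} (\<lambda>x. poisson_quotient t (unit_turn x))"
    by (intro borel_integrable_atLeastAtMost' continuous_on_poisson_quotient t)
  then show int: "integrable lborel ?q" by (simp add: set_integrable_def)
  \<comment> \<open>the mean of the Poisson kernel is 1: apply the averaging formula to the constant function 1\<close>
  have "complex_of_real (\<integral>x. ?q x \<partial>lborel) = 0"
    using integral_poisson_quotient[of "\<lambda>_. 1", OF _ t] by (simp del: of_real_mult flip: of_real_eq_0_iff)
  then have 0: "(\<integral>x. ?q x \<partial>lborel) = 0" by simp
  have i1: "integrable lborel (\<lambda>x :: real. indicator {0..1} x * 8 :: real)"
    by (intro integrable_mult_left integrable_real_indicator) auto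
  have i2: "integrable lborel (\<lambda>x. 4 * t * ?q x)" using int by (rule integrable_mult_right)
  have "(\<integral>x. \<bar>?q x\<bar> \<partial>lborel) \<le> (\<integral>x. indicator {0..1} x * 8 + 4 * t * ?q x \<partial>lborel)"
  proof (rule integral_mono)
    show "integrable lborel (\<lambda>x. \<bar>?q x\<bar>)" using int by simp
    show "integrable lborel (\<lambda>x. indicator {0..1} x * 8 + 4 * t * ?q x)"
      by (rule Bochner_Integration.integrable_add[OF i1 i2])
    show "\<bar>?q x\<bar> \<le> indicator {0..1} x * 8 + 4 * t * ?q x" for x
      using abs_poisson_quotient_le[OF norm_cis t, of "2 * pi * x"] by (simp split: split_indicator)
  qed
  also have "\<dots> = (\<integral>x. indicator {0..1} (x :: real) * 8 \<partial>lborel) + (\<integral>x. 4 * t * ?q x \<partial>lborel)"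
    by (rule Bochner_Integration.integral_add[OF i1 i2])
  also have "(\<integral>x. 4 * t * ?q x \<partial>lborel) = 4 * t * (\<integral>x. ?q x \<partial>lborel)"
    by (rule integral_mult_right_zero)
  finally show "(\<integral>x. \<bar>?q x\<bar> \<partial>lborel) \<le> 8" using 0 by simp
qed

text \<open>
  The weight \<open>(1 - t)\<^sup>\<alpha>\<^sup>-\<^sup>1\<close> in the variable \<open>s = 1 - t\<close>. The open interval keeps the divisor \<open>1 - s = t\<close>
  away from 0.
\<close>

definition power_weight :: "real \<Rightarrow> real \<Rightarrow> real" where
  "power_weight \<alpha> s = indicator {0<..<1} s * s powr (\<alpha> - 1)"

lemma integrable_power_weight:
  assumes "0 < \<alpha>"
  shows "integrable lborel (power_weight \<alpha>)"
proof -
  have "set_integrable lborel {0<..<1} (\<lambda>t. t powr (\<alpha> - 1) * (1 - t) powr (1 - 1))"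
    by (rule set_integrable_subset[OF integrable_Beta[of \<alpha> 1]]) (use assms in auto)
  \<comment> \<open>the factor \<open>(1 - s)\<^sup>0\<close> is 1 on the open interval\<close>
  then show ?thesis
    unfolding set_integrable_def
    by (rule back_subst[of "integrable lborel"]) (auto simp: power_weight_def split: split_indicator)
qed

lemma power_kernel_derivative:
  fixes c u a :: complex
  assumes "norm (c * u) < 1"
  shows "((\<lambda>u. 1 / (1 - c * u) powr a) has_field_derivative a * c / (1 - c * u) powr (a + 1)) (at u)"
proof -
  have "((\<lambda>u. (1 - c * u) powr (- a)) has_field_derivative (- a * (1 - c * u) powr (- a - 1)) * (- c)) (at u)"
    using one_minus_notin_nonpos_Reals[OF assms]
    by (intro DERIV_chain2[OF has_field_derivative_powr]) (auto intro!: derivative_eq_intros)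
  moreover have "(1 - c * u) powr (- a - 1) = 1 / (1 - c * u) powr (a + 1)"
    using powr_minus_divide[of "1 - c * u" "a + 1"] by simp
  ultimately show ?thesis by (simp add: powr_minus_divide)
qed

lemma continuous_on_power_kernel:
  fixes f :: "'a :: topological_space \<Rightarrow> complex"
  assumes "continuous_on A f" "\<And>x. x \<in> A \<Longrightarrow> norm (f x) < 1"
  shows "continuous_on A (\<lambda>x. 1 / (1 - f x) powr a)"
proof -
  have "1 - f x \<noteq> 0" "Re (1 - f x) \<ge> 0" if "x \<in> A" for x
    using Re_one_minus_pos[OF assms(2)[OF that]] by auto
  then show ?thesis using assms(1) by (intro continuous_intros) auto
qed

lemma norm_segment_mult_less:
  assumes "s \<in> {0..1}" "norm u < r"
  shows "norm (complex_of_real (1 - s) * u) < r"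
proof -
  have "norm (complex_of_real (1 - s)) \<le> 1"
    unfolding norm_of_real using assms(1) by simp
  then have "norm (complex_of_real (1 - s) * u) \<le> 1 * norm u"
    unfolding norm_mult by (rule mult_right_mono) simp
  then show ?thesis using assms(2) by simp
qed

text \<open>
  An antiderivative of the integrand on \<open>(0,1)\<close> is \<open>s\<^sup>\<alpha> (1 - (1 - s)u)\<^sup>-\<^sup>\<alpha>/(1 - u)\<close>. It is continuous up to
  the end point \<open>s = 0\<close>, where the integrand may be unbounded.
\<close>

lemma integral_power_weight_derivative:
  fixes u :: complex
  assumes \<alpha>: "0 < \<alpha>" and u: "norm u < 1"
  shows "(\<integral>s. of_real (power_weight \<alpha> s) * (of_real \<alpha> / (1 - of_real (1 - s) * u) powr (of_real \<alpha> + 1)) \<partial>lborel)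
       = 1 / (1 - u)" (is "integral\<^sup>L lborel ?f = _")
proof -
  have u1: "1 - u \<noteq> 0" using u by auto
  define D where "D s = 1 / (1 - of_real (1 - s) * u) powr of_real \<alpha>" for s :: real
  define \<phi> where "\<phi> s = of_real (s powr (\<alpha> - 1)) * (of_real \<alpha> / (1 - of_real (1 - s) * u) powr (of_real \<alpha> + 1))"
    for s :: real
  have seg: "norm (of_real (1 - s) * u) < 1" if "s \<in> {0..1}" for s :: real
    by (rule norm_segment_mult_less[OF that u])
  have "(\<phi> has_integral of_real (1 powr \<alpha>) * D 1 / (1 - u) - of_real (0 powr \<alpha>) * D 0 / (1 - u)) {0..1}"
  proof (rule fundamental_theorem_of_calculus_interior)
    have "continuous_on {0..1} D"
      unfolding D_def using seg by (intro continuous_on_power_kernel continuous_intros) auto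
    then show "continuous_on {0..1} (\<lambda>s. of_real (s powr \<alpha>) * D s / (1 - u))"
      using \<alpha> u1 by (intro continuous_intros continuous_on_powr') auto
    fix s :: real assume s: "s \<in> {0<..<1}"
    define c where "c = 1 - of_real (1 - s) * u"
    have pc: "norm (u * (1 - of_real s)) < 1" "norm (of_real (1 - s) * u) < 1"
      using seg[of s] s by (simp_all add: mult.commute)
    then have c0: "c \<noteq> 0" unfolding c_def by auto
    have d1: "((\<lambda>w. w powr of_real \<alpha>) has_field_derivative of_real \<alpha> * of_real s powr (of_real \<alpha> - 1)) (at (of_real s :: complex))"
      using s by (intro has_field_derivative_powr) (auto simp: complex_nonpos_Reals_iff)
    have "((\<lambda>w. 1 / (1 - u * (1 - w)) powr of_real \<alpha>) has_field_derivative
        of_real \<alpha> * u / (1 - u * (1 - of_real s)) powr (of_real \<alpha> + 1) * (- 1)) (at (of_real s :: complex))"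
      by (rule DERIV_chain2[where g = "\<lambda>w. 1 - w", OF power_kernel_derivative[OF pc(1)]])
         (auto intro!: derivative_eq_intros)
    then have d2: "((\<lambda>w. 1 / (1 - u * (1 - w)) powr of_real \<alpha>) has_field_derivative
        - (of_real \<alpha> * u / c powr (of_real \<alpha> + 1))) (at (of_real s :: complex))"
      by (simp add: c_def mult.commute)
    have "((\<lambda>w. w powr of_real \<alpha> * (1 / (1 - u * (1 - w)) powr of_real \<alpha>) / (1 - u)) has_field_derivative
       (of_real \<alpha> * of_real s powr (of_real \<alpha> - 1) * (1 / (1 - u * (1 - of_real s)) powr of_real \<alpha>)
        + - (of_real \<alpha> * u / c powr (of_real \<alpha> + 1)) * of_real s powr of_real \<alpha>) / (1 - u)) (at (of_real s :: complex))"
      by (intro DERIV_cdivide DERIV_mult d1 d2)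
    also have "(of_real \<alpha> * of_real s powr (of_real \<alpha> - 1) * (1 / (1 - u * (1 - of_real s)) powr of_real \<alpha>)
        + - (of_real \<alpha> * u / c powr (of_real \<alpha> + 1)) * of_real s powr of_real \<alpha>) / (1 - u) = \<phi> s"
    proof -
      define p where "p = complex_of_real (s powr (\<alpha> - 1))"
      define e where "e = c powr (of_real \<alpha> + 1)"
      have e0: "e \<noteq> 0" using c0 by (simp add: e_def)
      have "s powr \<alpha> = s powr (\<alpha> - 1) * s" using s powr_add[of s "\<alpha> - 1" 1] by simp
      then have p1: "of_real s powr of_real \<alpha> = p * of_real s"
        using s by (simp add: powr_of_real p_def)
      have p2: "of_real s powr (of_real \<alpha> - 1) = p"
        using s powr_of_real[of s "\<alpha> - 1"] by (simp add: p_def)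
      have "c powr of_real \<alpha> = e / c" using c0 by (simp add: e_def powr_add)
      then have e1: "1 / (1 - u * (1 - of_real s)) powr of_real \<alpha> = c / e"
        by (simp add: c_def mult.commute)
      have "(of_real \<alpha> * p * (c / e) + - (of_real \<alpha> * u / e) * (p * of_real s)) / (1 - u)
          = of_real \<alpha> * p / e * ((c - u * of_real s) / (1 - u))"
        using e0 u1 by (simp add: field_simps)
      also have "c - u * of_real s = 1 - u" by (simp add: c_def algebra_simps)
      finally show ?thesis
        unfolding p1 p2 e1 e_def[symmetric] \<phi>_def p_def[symmetric] c_def[symmetric] using u1 by simp
    qed
    finally have "((\<lambda>x. of_real x powr of_real \<alpha> * (1 / (1 - u * (1 - of_real x)) powr of_real \<alpha>) / (1 - u))
        has_vector_derivative \<phi> s) (at s)"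
      by (rule has_vector_derivative_real_field)
    then show "((\<lambda>s. of_real (s powr \<alpha>) * D s / (1 - u)) has_vector_derivative \<phi> s) (at s)"
    proof (rule has_vector_derivative_transform_within_open[where S = "{0<..<1}"])
      show "of_real x powr of_real \<alpha> * (1 / (1 - u * (1 - of_real x)) powr of_real \<alpha>) / (1 - u)
          = of_real (x powr \<alpha>) * D x / (1 - u)" if "x \<in> {0<..<1}" for x
        using that by (simp add: D_def powr_of_real mult.commute)
    qed (use s in auto)
  qed simp
  then have hi: "(\<phi> has_integral 1 / (1 - u)) {0..1}"
    using \<alpha> by (simp add: D_def)
  have feq: "?f = (\<lambda>s. indicator {0<..<1} s *\<^sub>R \<phi> s)"
    by (auto simp: power_weight_def \<phi>_def split: split_indicator)
  define k where "k s = of_real \<alpha> / (1 - of_real (1 - s) * u) powr (of_real \<alpha> + 1)" for s :: real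
  have kc: "continuous_on {0..1} k"
  proof -
    have "continuous_on {0..1} (\<lambda>s. of_real \<alpha> * (1 / (1 - of_real (1 - s) * u) powr (of_real \<alpha> + 1)))"
      using seg by (intro continuous_on_mult continuous_on_power_kernel continuous_intros) auto
    then show ?thesis by (simp add: k_def)
  qed
  then obtain C where C: "\<And>s. s \<in> {0..1} \<Longrightarrow> norm (k s) \<le> C"
    using compact_imp_bounded[OF compact_continuous_image[OF kc compact_Icc]] unfolding bounded_iff by blast
  have "integrable lborel (\<lambda>s. of_real (power_weight \<alpha> s) * (indicator {0..1} s *\<^sub>R k s))"
  proof (rule integrable_mult_bounded_measurable[where C = "\<bar>C\<bar>"])
    show "integrable lborel (\<lambda>s. complex_of_real (power_weight \<alpha> s))"
      using integrable_power_weight[OF \<alpha>] by simp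
    show "(\<lambda>s. indicator {0..1} s *\<^sub>R k s) \<in> borel_measurable lborel"
      using borel_measurable_continuous_on_indicator[OF _ kc] by simp
    show "norm (indicator {0..1} s *\<^sub>R k s) \<le> \<bar>C\<bar>" for s
      using C[of s] by (auto split: split_indicator)
  qed
  then have "set_integrable lborel {0<..<1} \<phi>"
    unfolding set_integrable_def
    by (rule back_subst[of "integrable lborel"])
       (auto simp: power_weight_def \<phi>_def k_def split: split_indicator)
  from set_borel_integral_eq_integral(2)[OF this]
  have "integral\<^sup>L lborel ?f = integral {0<..<1} \<phi>"
    unfolding feq set_lebesgue_integral_def by simp
  also have "\<dots> = 1 / (1 - u)"
    using hi unfolding has_integral_Icc_iff_Ioo by (rule integral_unique)
  finally show ?thesis .
qed

lemma log_as_power_integral: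
  assumes \<alpha>: "0 < \<alpha>" and u: "u \<in> unit_disk"
  shows "(\<integral>s. of_real (power_weight \<alpha> s) *
            ((1 / (1 - of_real (1 - s) * u) powr of_real \<alpha> - 1) / of_real (1 - s)) \<partial>lborel)
       = ln (1 / (1 - u))"
proof (rule eq_on_unit_disk_if_deriv_eq[where d = "\<lambda>z. 1 / (1 - z)" and g = "\<lambda>u. ln (1 / (1 - u))"
    and f = "\<lambda>u. \<integral>s. of_real (power_weight \<alpha> s) *
            ((1 / (1 - of_real (1 - s) * u) powr of_real \<alpha> - 1) / of_real (1 - s)) \<partial>lborel", OF _ _ _ u])
  let ?k = "\<lambda>s u. (1 / (1 - complex_of_real (1 - s) * u) powr of_real \<alpha> - 1) / of_real (1 - s)"
  let ?k' = "\<lambda>s u. of_real \<alpha> / (1 - complex_of_real (1 - s) * u) powr (of_real \<alpha> + 1)"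
  have w0: "s \<in> {0<..<1}" if "complex_of_real (power_weight \<alpha> s) \<noteq> 0" for s
    using that by (auto simp: power_weight_def split: split_indicator_asm)
  have pw: "of_real (power_weight \<alpha> s) * c = of_real (power_weight \<alpha> s) * (indicator {0<..<1} s *\<^sub>R c)"
    for s and c :: complex
    by (simp add: power_weight_def split: split_indicator)
  have mw: "(\<lambda>s. complex_of_real (power_weight \<alpha> s)) \<in> borel_measurable lborel"
    using borel_measurable_integrable[OF integrable_power_weight[OF \<alpha>]] by measurable
  have meas: "(\<lambda>s. of_real (power_weight \<alpha> s) * f s) \<in> borel_measurable lborel"
    if "continuous_on {0<..<1} f" for f :: "real \<Rightarrow> complex"
    using borel_measurable_continuous_on_indicator[OF _ that] mw
    by (subst pw) (intro borel_measurable_times, auto)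
  show "((\<lambda>u. \<integral>s. of_real (power_weight \<alpha> s) * ?k s u \<partial>lborel) has_field_derivative 1 / (1 - z)) (at z)"
    if z: "z \<in> unit_disk" for z
  proof -
    obtain r where r: "norm z < r" "r < 1" using z dense[of "norm z" 1] by auto
    then have r0: "0 < r" using norm_ge_zero[of z] by linarith
    have "((\<lambda>u. \<integral>s. of_real (power_weight \<alpha> s) * ?k s u \<partial>lborel) has_field_derivative
        (\<integral>s. of_real (power_weight \<alpha> s) * ?k' s z \<partial>lborel)) (at z)"
    proof (rule has_field_derivative_parametric_integral[where U = "ball 0 r" and ?z1.0 = 0
          and C = "\<alpha> / (1 - r) powr (\<alpha> + 1)"])
      show "integrable lborel (\<lambda>s. complex_of_real (power_weight \<alpha> s))"
        using integrable_power_weight[OF \<alpha>] by simp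
      fix s :: real assume "complex_of_real (power_weight \<alpha> s) \<noteq> 0"
      then have s: "s \<in> {0<..<1}" and s': "s \<in> {0..1}" using w0[of s] by auto
      fix w :: complex assume w: "w \<in> ball 0 r"
      have n: "norm (complex_of_real (1 - s) * w) < r"
        using norm_segment_mult_less[OF s', of w r] w by simp
      then have n1: "norm (complex_of_real (1 - s) * w) < 1" using r by simp
      have "(?k s has_field_derivative (of_real \<alpha> * of_real (1 - s) / (1 - complex_of_real (1 - s) * w) powr (of_real \<alpha> + 1) - 0) / of_real (1 - s)) (at w)"
        by (intro DERIV_cdivide DERIV_diff DERIV_const power_kernel_derivative[OF n1])
      moreover have "complex_of_real (1 - s) \<noteq> 0" using s by (simp add: complex_eq_iff)
      ultimately show "(?k s has_field_derivative ?k' s w) (at w)" by simp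
      have "1 - r \<le> norm (1 - complex_of_real (1 - s) * w)"
        using norm_triangle_ineq2[of 1 "complex_of_real (1 - s) * w"] n by simp
      then have "(1 - r) powr (\<alpha> + 1) \<le> norm (1 - complex_of_real (1 - s) * w) powr (\<alpha> + 1)"
        using r \<alpha> by (intro powr_mono2) auto
      moreover have "norm (?k' s w) = \<alpha> / norm (1 - complex_of_real (1 - s) * w) powr (\<alpha> + 1)"
        using norm_powr_real_powr'[of "of_real (\<alpha> + 1)" "1 - complex_of_real (1 - s) * w"] \<alpha>
        by (simp add: norm_divide)
      ultimately show "norm (?k' s w) \<le> \<alpha> / (1 - r) powr (\<alpha> + 1)"
        using r \<alpha> by (auto intro!: divide_left_mono mult_pos_pos)
    next
      fix w :: complex assume w: "w \<in> ball 0 r"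
      show "(\<lambda>s. of_real (power_weight \<alpha> s) * ?k s w) \<in> borel_measurable lborel"
      proof (rule meas, rule continuous_on_divide[OF continuous_on_diff[OF continuous_on_power_kernel continuous_on_const]])
        show "norm (complex_of_real (1 - s) * w) < 1" if "s \<in> {0<..<1}" for s
          using norm_segment_mult_less[of s w 1] that w r by simp
        show "\<forall>s\<in>{0<..<1}. complex_of_real (1 - s) \<noteq> 0" by (simp add: complex_eq_iff)
      qed (intro continuous_intros)+
    next
      have "continuous_on {0<..<1} (\<lambda>s. of_real \<alpha> * (1 / (1 - complex_of_real (1 - s) * z) powr (of_real \<alpha> + 1)))"
      proof (intro continuous_on_mult continuous_on_power_kernel)
        show "norm (complex_of_real (1 - s) * z) < 1" if "s \<in> {0<..<1}" for s
          using norm_segment_mult_less[of s z 1] that z by simp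
      qed (intro continuous_intros)+
      from meas[OF this] show "(\<lambda>s. of_real (power_weight \<alpha> s) * ?k' s z) \<in> borel_measurable lborel"
        by simp
    qed (use r r0 in auto)
    then show ?thesis
      using integral_power_weight_derivative[OF \<alpha>, of z] z by simp
  qed
  show "((\<lambda>u. ln (1 / (1 - u))) has_field_derivative 1 / (1 - z)) (at z)" if z: "z \<in> unit_disk" for z
  proof (rule has_field_derivative_transform_within_open[OF _ open_ball z])
    show "((\<lambda>u. - ln (1 - u)) has_field_derivative 1 / (1 - z)) (at z)"
      using one_minus_notin_nonpos_Reals[of z] z by (auto intro!: derivative_eq_intros simp: divide_simps)
    show "- ln (1 - w) = ln (1 / (1 - w))" if "w \<in> unit_disk" for w
      using that by (simp add: Ln_inverse_one_minus)
  qed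
qed simp

lemma bounded_measurable_power_kernel:
  assumes "u \<in> unit_disk"
  shows "bounded_measurable circle_borel (\<lambda>\<zeta>. 1 / (1 - cnj \<zeta> * u) powr a)"
  by (rule bounded_measurable_continuous_on, rule continuous_on_power_kernel)
     (intro continuous_intros, rule norm_cnj_circle_mult_less[OF _ assms])

text \<open>
  The circle measure is the image of \<open>s\<^sup>\<alpha>\<^sup>-\<^sup>1 q\<^sub>1\<^sub>-\<^sub>s ds dx\<close> on the unit square. Conjugation in the map to the
  circle turns the antiholomorphic kernel into a holomorphic function of the circle variable.
\<close>

lemma log_as_power_average:
  assumes \<alpha>: "0 < \<alpha>"
  obtains L :: "(complex \<Rightarrow> complex) \<Rightarrow> complex" where "represented circle_borel L"
    "\<And>u. u \<in> unit_disk \<Longrightarrow> L (\<lambda>\<zeta>. 1 / (1 - cnj \<zeta> * u) powr of_real \<alpha>) = ln (1 / (1 - u))"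
proof -
  define q where "q s x = indicator {0..1} x * poisson_quotient (1 - s) (unit_turn x)" for s x
  define H where "H = (\<lambda>(s, x). power_weight \<alpha> s * q s x)"
  define X where "X = (\<lambda>(s :: real, x). cnj (unit_turn x))"
  have mc: "(\<lambda>p. unit_turn (snd p)) \<in> borel_measurable (lborel \<Otimes>\<^sub>M lborel)"
  proof -
    have "cis \<in> borel_measurable borel" by (intro borel_measurable_continuous_onI continuous_intros)
    moreover have "(\<lambda>p. 2 * pi * snd p) \<in> borel_measurable (lborel \<Otimes>\<^sub>M lborel)" by measurable
    ultimately show ?thesis by (rule measurable_compose[rotated])
  qed
  have mw: "power_weight \<alpha> \<in> borel_measurable lborel"
    using integrable_power_weight[OF \<alpha>] by (rule borel_measurable_integrable)
  have mH: "H \<in> borel_measurable (lborel \<Otimes>\<^sub>M lborel)"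
  proof -
    have "(\<lambda>p. power_weight \<alpha> (fst p) * (indicator {0..1} (snd p) *
        (2 * Re (1 / (unit_turn (snd p) - of_real (1 - fst p)))))) \<in> borel_measurable (lborel \<Otimes>\<^sub>M lborel)"
      using mc mw by measurable
    then show ?thesis by (simp add: H_def q_def poisson_quotient_def case_prod_unfold)
  qed
  have iH: "integrable (lborel \<Otimes>\<^sub>M lborel) H"
  proof (rule lborel_pair.Fubini_integrable[OF mH])
    have inner: "integrable lborel (\<lambda>x. H (s, x))" for s
    proof (cases "s \<in> {0<..<1}")
      case True
      then show ?thesis
        using integral_abs_poisson_quotient_le(1)[of "1 - s"] by (simp add: H_def q_def)
    qed (simp add: H_def power_weight_def)
    then show "AE s in lborel. integrable lborel (\<lambda>x. H (s, x))" by simp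
    show "integrable lborel (\<lambda>s. \<integral>x. norm (H (s, x)) \<partial>lborel)"
    proof (rule Bochner_Integration.integrable_bound)
      show "integrable lborel (\<lambda>s. 8 * power_weight \<alpha> s)" using integrable_power_weight[OF \<alpha>] by simp
      show "(\<lambda>s. \<integral>x. norm (H (s, x)) \<partial>lborel) \<in> borel_measurable lborel"
        using mH by measurable
      show "AE s in lborel. norm (\<integral>x. norm (H (s, x)) \<partial>lborel) \<le> norm (8 * power_weight \<alpha> s)"
      proof (rule AE_I2)
        fix s :: real
        show "norm (\<integral>x. norm (H (s, x)) \<partial>lborel) \<le> norm (8 * power_weight \<alpha> s)"
        proof (cases "s \<in> {0<..<1}")
          case True
          have "(\<integral>x. norm (H (s, x)) \<partial>lborel) = \<bar>power_weight \<alpha> s\<bar> * (\<integral>x. \<bar>q s x\<bar> \<partial>lborel)"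
            by (simp add: H_def abs_mult)
          also have "\<dots> \<le> \<bar>power_weight \<alpha> s\<bar> * 8"
            using integral_abs_poisson_quotient_le(2)[of "1 - s"] True
            by (intro mult_left_mono) (auto simp: q_def)
          finally show ?thesis by (simp add: abs_mult)
        qed (simp add: H_def power_weight_def)
      qed
    qed
  qed
  have mX: "X \<in> measurable (lborel \<Otimes>\<^sub>M lborel) circle_borel"
    unfolding circle_borel_def
  proof (rule measurable_restrict_space2)
    show "X \<in> borel_measurable (lborel \<Otimes>\<^sub>M lborel)"
      using measurable_compose[OF mc borel_measurable_continuous_onI[of cnj]]
      by (simp add: X_def case_prod_unfold continuous_on_cnj)
  qed (auto simp: X_def)
  define L :: "(complex \<Rightarrow> complex) \<Rightarrow> complex" where "L g = (\<integral>p. of_real (H p) * g (X p) \<partial>(lborel \<Otimes>\<^sub>M lborel))" for g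
  have "represented circle_borel L"
    unfolding L_def using iH mX by (intro represented_pushforward) auto
  moreover have "L (\<lambda>\<zeta>. 1 / (1 - cnj \<zeta> * u) powr of_real \<alpha>) = ln (1 / (1 - u))" if u: "u \<in> unit_disk" for u
  proof -
    define G where "G w = 1 / (1 - u * w) powr complex_of_real \<alpha>" for w
    have G: "G holomorphic_on cball 0 1"
    proof -
      have "norm (u * w) < 1" if "w \<in> cball 0 1" for w
      proof -
        have "norm (u * w) \<le> norm u * 1" using that unfolding norm_mult by (intro mult_left_mono) auto
        then show ?thesis using u by simp
      qed
      then show ?thesis
        unfolding G_def holomorphic_on_def field_differentiable_def
        using has_field_derivative_at_within[OF power_kernel_derivative] by blast
    qed
    let ?F = "\<lambda>p. of_real (H p) * (1 / (1 - cnj (X p) * u) powr of_real \<alpha>)"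
    have int: "integrable (lborel \<Otimes>\<^sub>M lborel) ?F"
    proof -
      let ?g = "\<lambda>\<zeta>. 1 / (1 - cnj \<zeta> * u) powr complex_of_real \<alpha>"
      obtain C where C: "\<And>\<zeta>. \<zeta> \<in> sphere 0 1 \<Longrightarrow> norm (?g \<zeta>) \<le> C"
        and g: "?g \<in> borel_measurable circle_borel"
        using bounded_measurable_power_kernel[OF u, of "of_real \<alpha>"]
        unfolding bounded_measurable_def space_circle_borel by blast
      show ?thesis
      proof (rule integrable_mult_bounded_measurable)
        show "integrable (lborel \<Otimes>\<^sub>M lborel) (\<lambda>p. complex_of_real (H p))" using iH by simp
        show "(\<lambda>p. ?g (X p)) \<in> borel_measurable (lborel \<Otimes>\<^sub>M lborel)"
          by (rule measurable_compose[OF mX g])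
        show "norm (?g (X p)) \<le> C" for p by (rule C) (auto simp: X_def split: prod.split)
      qed
    qed
    have "L (\<lambda>\<zeta>. 1 / (1 - cnj \<zeta> * u) powr of_real \<alpha>) = (\<integral>s. (\<integral>x. ?F (s, x) \<partial>lborel) \<partial>lborel)"
      unfolding L_def by (rule lborel_pair.integral_fst'[OF int, symmetric])
    also have "\<dots> = (\<integral>s. of_real (power_weight \<alpha> s) *
            ((1 / (1 - of_real (1 - s) * u) powr of_real \<alpha> - 1) / of_real (1 - s)) \<partial>lborel)"
    proof (rule Bochner_Integration.integral_cong[OF refl])
      fix s :: real
      have "(\<integral>x. ?F (s, x) \<partial>lborel) = of_real (power_weight \<alpha> s) * (\<integral>x. of_real (q s x) * G (unit_turn x) \<partial>lborel)"
        unfolding integral_mult_right_zero[symmetric]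
        by (intro Bochner_Integration.integral_cong) (simp_all add: H_def X_def G_def mult.commute)
      also have "\<dots> = of_real (power_weight \<alpha> s) *
            ((1 / (1 - of_real (1 - s) * u) powr of_real \<alpha> - 1) / of_real (1 - s))"
      proof (cases "s \<in> {0<..<1}")
        case True
        then have t: "0 < 1 - s" "1 - s < 1" by auto
        show ?thesis
          unfolding q_def integral_poisson_quotient[OF G t] by (simp add: G_def mult.commute)
      qed (simp add: power_weight_def)
      finally show "(\<integral>x. ?F (s, x) \<partial>lborel) = of_real (power_weight \<alpha> s) *
            ((1 / (1 - of_real (1 - s) * u) powr of_real \<alpha> - 1) / of_real (1 - s))" .
    qed
    also have "\<dots> = ln (1 / (1 - u))" by (rule log_as_power_integral[OF \<alpha> u])
    finally show ?thesis .
  qed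
  ultimately show thesis using that by blast
qed

section \<open>Convolution on the circle\<close>

text \<open>
  The complex measure of \<open>L\<close> is the multiplicative convolution on the circle of those of \<open>L1\<close> and
  \<open>L2\<close>. The inner integral is passed as a separate function \<open>G\<close> because \<open>L1\<close> can be evaluated only on a
  bounded measurable argument.
\<close>

lemma represented_convolution:
  assumes "represented circle_borel L1" "represented circle_borel L2"
  obtains L where "represented circle_borel L"
    "\<And>g G. continuous_on (sphere 0 1) g \<Longrightarrow> bounded_measurable circle_borel G \<Longrightarrow>
       (\<And>\<xi>. \<xi> \<in> sphere 0 1 \<Longrightarrow> L2 (\<lambda>\<zeta>. g (\<xi> * \<zeta>)) = G \<xi>) \<Longrightarrow> L g = L1 G"
proof -
  from assms(1) obtain S h where S: "finite_measure S" "sets S = sets circle_borel" and h: "integrable S h"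
    and L1: "\<And>g. bounded_measurable circle_borel g \<Longrightarrow> L1 g = (\<integral>x. h x * g x \<partial>S)"
    unfolding represented_def by blast
  from assms(2) obtain T k where T: "finite_measure T" "sets T = sets circle_borel" and k: "integrable T k"
    and L2: "\<And>g. bounded_measurable circle_borel g \<Longrightarrow> L2 g = (\<integral>x. k x * g x \<partial>T)"
    unfolding represented_def by blast
  have sp: "space S = sphere 0 1" "space T = sphere 0 1"
    using sets_eq_imp_space_eq[OF S(2)] sets_eq_imp_space_eq[OF T(2)] by simp_all
  interpret S: finite_measure S by fact
  interpret T: finite_measure T by fact
  interpret P: pair_sigma_finite S T ..
  have hm: "h \<in> borel_measurable S" and km: "k \<in> borel_measurable T" using h k by auto
  have idm: "(\<lambda>x. x) \<in> borel_measurable S" "(\<lambda>x. x) \<in> borel_measurable T"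
    using S(2) T(2) unfolding circle_borel_def
    by (simp_all cong: measurable_cong_sets add: measurable_restrict_space1)
  define H where "H = (\<lambda>(x, y). h x * k y)"
  define X where "X = (\<lambda>(x, y). x * y :: complex)"
  have mH: "H \<in> borel_measurable (S \<Otimes>\<^sub>M T)"
    unfolding H_def using hm km by measurable
  have iH: "integrable (S \<Otimes>\<^sub>M T) H"
  proof (rule P.Fubini_integrable[OF mH])
    show "AE x in S. integrable T (\<lambda>y. H (x, y))" using k by (simp add: H_def)
    have "integrable S (\<lambda>x. norm (h x) * (\<integral>y. norm (k y) \<partial>T))" using h by simp
    then show "integrable S (\<lambda>x. \<integral>y. norm (H (x, y)) \<partial>T)" by (simp add: H_def norm_mult)
  qed
  have mX: "X \<in> measurable (S \<Otimes>\<^sub>M T) circle_borel"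
    unfolding circle_borel_def
  proof (rule measurable_restrict_space2)
    show "X \<in> borel_measurable (S \<Otimes>\<^sub>M T)" unfolding X_def using idm by measurable
    show "X \<in> space (S \<Otimes>\<^sub>M T) \<rightarrow> sphere 0 1"
      using sp by (auto simp: X_def space_pair_measure norm_mult)
  qed
  define L where "L g = (\<integral>p. H p * g (X p) \<partial>(S \<Otimes>\<^sub>M T))" for g
  have "represented circle_borel L"
    unfolding L_def using iH mX by (rule represented_pushforward)
  moreover have "L g = L1 G"
    if g: "continuous_on (sphere 0 1) g" and G: "bounded_measurable circle_borel G"
      and eq: "\<And>\<xi>. \<xi> \<in> sphere 0 1 \<Longrightarrow> L2 (\<lambda>\<zeta>. g (\<xi> * \<zeta>)) = G \<xi>" for g G
  proof -
    obtain C where gm: "g \<in> borel_measurable circle_borel" and C: "\<And>x. x \<in> sphere 0 1 \<Longrightarrow> norm (g x) \<le> C"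
      using bounded_measurable_continuous_on[OF g] unfolding bounded_measurable_def space_circle_borel by blast
    have "integrable (S \<Otimes>\<^sub>M T) (\<lambda>p. H p * g (X p))"
    proof (rule integrable_mult_bounded_measurable[OF iH])
      show "(\<lambda>p. g (X p)) \<in> borel_measurable (S \<Otimes>\<^sub>M T)" by (rule measurable_compose[OF mX gm])
      show "norm (g (X p)) \<le> C" if "p \<in> space (S \<Otimes>\<^sub>M T)" for p
        using C measurable_space[OF mX that] by simp
    qed
    from P.integral_fst'[OF this]
    have "L g = (\<integral>x. (\<integral>y. h x * (k y * g (x * y)) \<partial>T) \<partial>S)"
      by (simp add: L_def H_def X_def mult.assoc)
    also have "\<dots> = (\<integral>x. h x * G x \<partial>S)"
    proof (rule Bochner_Integration.integral_cong[OF refl])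
      fix x assume "x \<in> space S"
      then have x: "x \<in> sphere 0 1" using sp by simp
      have "continuous_on (sphere 0 1) (\<lambda>y. g (x * y))"
        using x by (intro continuous_on_compose2[OF g] continuous_intros) (auto simp: norm_mult)
      then have "(\<integral>y. k y * g (x * y) \<partial>T) = G x"
        using L2[OF bounded_measurable_continuous_on] eq[OF x] by simp
      then show "(\<integral>y. h x * (k y * g (x * y)) \<partial>T) = h x * G x"
        by (simp only: integral_mult_right_zero)
    qed
    also have "\<dots> = L1 G" by (rule L1[OF G, symmetric])
    finally show ?thesis .
  qed
  ultimately show thesis using that by blast
qed

lemma J_family_subset_F_pos:
  assumes \<alpha>: "0 < \<alpha>"
  shows "J_family \<subseteq> F_family \<alpha>"
proof
  fix f assume f: "f \<in> J_family"
  obtain L1 where L1: "represented circle_borel L1"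
    "\<And>z. z \<in> unit_disk \<Longrightarrow> f z = L1 (\<lambda>\<xi>. ln (1 / (1 - cnj \<xi> * z)))"
    using J_family_log_representation[OF f] by blast
  obtain L2 where L2: "represented circle_borel L2"
    "\<And>u. u \<in> unit_disk \<Longrightarrow> L2 (\<lambda>\<zeta>. 1 / (1 - cnj \<zeta> * u) powr of_real \<alpha>) = ln (1 / (1 - u))"
    using log_as_power_average[OF \<alpha>] by blast
  obtain L where L: "represented circle_borel L"
    "\<And>g G. continuous_on (sphere 0 1) g \<Longrightarrow> bounded_measurable circle_borel G \<Longrightarrow>
       (\<And>\<xi>. \<xi> \<in> sphere 0 1 \<Longrightarrow> L2 (\<lambda>\<zeta>. g (\<xi> * \<zeta>)) = G \<xi>) \<Longrightarrow> L g = L1 G"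
    using represented_convolution[OF L1(1) L2(1)] by blast
  obtain \<mu> where \<mu>: "complex_measure circle_borel \<mu>"
    "\<And>g. bounded_measurable circle_borel g \<Longrightarrow> L g = complex_integral circle_borel \<mu> g"
    using represented_imp_complex_integral[OF L(1)] by blast
  have eq: "f z = complex_integral circle_borel \<mu> (\<lambda>\<xi>. 1 / (1 - cnj \<xi> * z) powr complex_of_real \<alpha>)"
    if z: "z \<in> unit_disk" for z
  proof -
    have "L (\<lambda>\<xi>. 1 / (1 - cnj \<xi> * z) powr of_real \<alpha>) = L1 (\<lambda>\<xi>. ln (1 / (1 - cnj \<xi> * z)))"
    proof (rule L(2)[OF _ bounded_measurable_log_kernel[OF z]])
      show "continuous_on (sphere 0 1) (\<lambda>\<xi>. 1 / (1 - cnj \<xi> * z) powr complex_of_real \<alpha>)"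
        by (rule continuous_on_power_kernel)
           (intro continuous_intros, rule norm_cnj_circle_mult_less[OF _ z])
      fix \<xi> :: complex assume "\<xi> \<in> sphere 0 1"
      then have "cnj \<xi> * z \<in> unit_disk" using norm_cnj_circle_mult_less[OF _ z] by simp
      from L2(2)[OF this]
      show "L2 (\<lambda>\<zeta>. 1 / (1 - cnj (\<xi> * \<zeta>) * z) powr complex_of_real \<alpha>) = ln (1 / (1 - cnj \<xi> * z))"
        by (simp add: mult_ac)
    qed
    then show ?thesis
      using L1(2)[OF z] \<mu>(2)[OF bounded_measurable_power_kernel[OF z]] by simp
  qed
  have "\<mu> \<in> circle_measures" using \<mu>(1) by (simp add: circle_measures_def)
  moreover have "\<alpha> \<noteq> 0" using \<alpha> by simp
  ultimately show "f \<in> F_family \<alpha>"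
    unfolding F_family_def mem_Collect_eq if_not_P[OF \<open>\<alpha> \<noteq> 0\<close>] using J_family_analytic[OF f] eq by blast
qed

section \<open>Composition with disk automorphisms\<close>

lemma disk_auto_in_unit_disk:
  assumes a: "-1 < a" "a < 1" and z: "z \<in> unit_disk"
  shows "disk_auto a z \<in> unit_disk" "norm (z * of_real a) < 1"
proof -
  have nz: "norm z < 1" using z by simp
  have na: "\<bar>a\<bar> < 1" using a by linarith
  have "norm z * \<bar>a\<bar> < 1" using nz na by (smt (verit) mult_le_cancel_left2 mult_nonneg_nonneg norm_ge_zero)
  then show 1: "norm (z * of_real a) < 1" by (simp add: norm_mult)
  then have ne: "1 + z * of_real a \<noteq> 0" by (metis add.inverse_unique less_irrefl norm_minus_cancel norm_one)
  have "0 < (1 - a\<^sup>2) * (1 - (norm z)\<^sup>2)"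
    using nz na by (intro mult_pos_pos) (auto simp: abs_square_less_1 power_less_one_iff)
  also have "\<dots> = (norm (1 + z * of_real a))\<^sup>2 - (norm (z + of_real a))\<^sup>2"
    unfolding cmod_power2 by (simp add: power2_eq_square algebra_simps)
  finally have "norm (z + of_real a) < norm (1 + z * of_real a)"
    by (simp add: power_less_imp_less_base)
  then show "disk_auto a z \<in> unit_disk"
    using ne by (simp add: disk_auto_def norm_divide divide_less_eq)
qed

lemma circle_auto:
  assumes a: "-1 < a" "a < 1" and \<xi>: "\<xi> \<in> sphere 0 1"
  shows "disk_auto (- a) \<xi> \<in> sphere 0 1" "1 - \<xi> * of_real a \<noteq> 0"
    "cnj (disk_auto (- a) \<xi>) = disk_auto (- a) (cnj \<xi>)"
proof -
  have n: "norm \<xi> = 1" using \<xi> by simp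
  have "norm (\<xi> * of_real a) < 1" using a n by (simp add: norm_mult)
  then show ne: "1 - \<xi> * of_real a \<noteq> 0" by auto
  have "norm (\<xi> - of_real a) = norm (1 - \<xi> * of_real a)"
  proof -
    have "\<xi> * (1 - cnj \<xi> * of_real a) = \<xi> - of_real a"
      using n complex_norm_square[of \<xi>] by (simp add: right_diff_distrib mult.assoc[symmetric])
    then have "norm (\<xi> - of_real a) = norm (cnj (1 - \<xi> * of_real a))"
      using n by (metis (no_types) complex_cnj_complex_of_real complex_cnj_diff complex_cnj_mult complex_cnj_one mult_1 norm_mult)
    then show ?thesis by (simp only: complex_mod_cnj)
  qed
  then show "disk_auto (- a) \<xi> \<in> sphere 0 1"
    using ne by (simp add: disk_auto_def norm_divide)
  show "cnj (disk_auto (- a) \<xi>) = disk_auto (- a) (cnj \<xi>)"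
    by (simp add: disk_auto_def)
qed

text \<open>
  The factors satisfy \<open>A D = B C\<close>, so the two sides differ by a multiple of \<open>2\<pi>\<i>\<close>. Each of the four
  arguments is below \<open>\<pi>/2\<close> in modulus, hence the difference is below \<open>2\<pi>\<close> and vanishes.
\<close>

lemma Ln_disk_auto:
  assumes a: "-1 < a" "a < 1" and \<xi>: "\<xi> \<in> sphere 0 1" and z: "z \<in> unit_disk"
  shows "ln (1 - \<xi> * disk_auto a z)
       = ln (1 - \<xi> * of_real a) + ln (1 - disk_auto (- a) \<xi> * z) - ln (1 + z * of_real a)"
    (is "ln ?A = ln ?B + ln ?C - ln ?D")
proof -
  have pos: "0 < Re ?A" "0 < Re ?B" "0 < Re ?C" "0 < Re ?D"
    using Re_one_minus_pos[OF norm_circle_mult_less[OF \<xi> disk_auto_in_unit_disk(1)[OF a z]]]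
      Re_one_minus_pos[OF norm_circle_mult_less[OF \<xi>, of "of_real a"]]
      Re_one_minus_pos[OF norm_circle_mult_less[OF circle_auto(1)[OF a \<xi>] z]]
      Re_one_minus_pos[of "- (z * of_real a)"] disk_auto_in_unit_disk(2)[OF a z] a
    by (auto simp del: one_complex.sel minus_complex.sel)
  have "w \<noteq> 0" if "0 < Re w" for w using that by auto
  then have ne: "?A \<noteq> 0" "?B \<noteq> 0" "?C \<noteq> 0" "?D \<noteq> 0" using pos by blast+
  \<comment> \<open>clear the denominators of the two Moebius maps\<close>
  have AD: "?A * ?D = ?B * ?C"
    using ne(2,4) by (simp add: disk_auto_def field_simps)
  have "exp (ln ?A - (ln ?B + ln ?C - ln ?D)) = 1"
    using ne AD by (simp add: exp_diff exp_add)
  then obtain n :: int where n: "Re (ln ?A - (ln ?B + ln ?C - ln ?D)) = 0"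
    "Im (ln ?A - (ln ?B + ln ?C - ln ?D)) = of_int (2 * n) * pi"
    unfolding exp_eq_1 by blast
  have "\<bar>Im (ln ?A)\<bar> < pi / 2" "\<bar>Im (ln ?B)\<bar> < pi / 2" "\<bar>Im (ln ?C)\<bar> < pi / 2" "\<bar>Im (ln ?D)\<bar> < pi / 2"
    using Re_Ln_pos_lt[OF ne(1)] Re_Ln_pos_lt[OF ne(2)] Re_Ln_pos_lt[OF ne(3)]
      Re_Ln_pos_lt[OF ne(4)] pos by blast+
  then have "\<bar>Im (ln ?A - (ln ?B + ln ?C - ln ?D))\<bar> < 2 * pi" by simp
  then have "\<bar>of_int n\<bar> * (2 * pi) < 1 * (2 * pi)" unfolding n(2) by (simp add: abs_mult)
  then have "\<bar>of_int n :: real\<bar> < 1" by (rule mult_right_less_imp_less) simp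
  then have "n = 0" by linarith
  then have "ln ?A - (ln ?B + ln ?C - ln ?D) = 0" using n by (simp add: complex_eq_iff)
  then show ?thesis by simp
qed

lemma J_kernel_disk_auto:
  assumes a: "-1 < a" "a < 1" and \<xi>: "\<xi> \<in> sphere 0 1" and z: "z \<in> unit_disk"
  defines "k \<equiv> \<lambda>\<xi> z. ln ((1 - \<xi> * z) / (1 - cnj \<xi> * z))"
  shows "k \<xi> (disk_auto a z) - k \<xi> (disk_auto a 0) = k (disk_auto (- a) \<xi>) z"
proof -
  have z0: "0 \<in> unit_disk" by simp
  note da = disk_auto_in_unit_disk(1)[OF a]
  have c: "cnj \<xi> \<in> sphere 0 1" using \<xi> by simp
  have "k \<xi> (disk_auto a w) = ln (1 - \<xi> * of_real a) + ln (1 - disk_auto (- a) \<xi> * w)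
     - (ln (1 - cnj \<xi> * of_real a) + ln (1 - disk_auto (- a) (cnj \<xi>) * w))" if "w \<in> unit_disk" for w
    unfolding k_def J_kernel_eq[OF \<xi> da[OF that]] Ln_disk_auto[OF a \<xi> that] Ln_disk_auto[OF a c that]
    by simp
  moreover have "k (disk_auto (- a) \<xi>) z = ln (1 - disk_auto (- a) \<xi> * z) - ln (1 - disk_auto (- a) (cnj \<xi>) * z)"
    using J_kernel_eq[OF circle_auto(1)[OF a \<xi>] z] unfolding k_def circle_auto(3)[OF a \<xi>] .
  ultimately show ?thesis using z z0 by simp
qed

lemma J_family_disk_auto:
  assumes a: "-1 < a" "a < 1" and f: "f \<in> J_family"
  shows "(\<lambda>z. (f \<circ> disk_auto a) z - (f \<circ> disk_auto a) 0) \<in> J_family"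
proof -
  let ?k = "\<lambda>\<xi> z. ln ((1 - \<xi> * z) / (1 - cnj \<xi> * z))"
  obtain S h where S: "finite_measure S" "sets S = sets circle_borel" and h: "integrable S h"
    and f: "\<And>z. z \<in> unit_disk \<Longrightarrow> f z = (\<integral>\<xi>. h \<xi> * ?k \<xi> z \<partial>S)"
    using J_family_representation[OF f] by blast
  have sp: "space S = sphere 0 1" using sets_eq_imp_space_eq[OF S(2)] by simp
  have i: "integrable S (\<lambda>\<xi>. h \<xi> * ?k \<xi> z)" if "z \<in> unit_disk" for z
  proof -
    have "g \<in> borel_measurable S" "\<exists>C. \<forall>\<xi>\<in>space S. norm (g \<xi>) \<le> C" if "bounded_measurable circle_borel g" for g
      using that S(2) sp unfolding bounded_measurable_def by (simp_all cong: measurable_cong_sets)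
    then show ?thesis
      using bounded_measurable_J_kernel[OF that] integrable_mult_bounded_measurable[OF h] by blast
  qed
  have "continuous_on (sphere 0 1) (disk_auto (- a))"
    unfolding disk_auto_def using circle_auto(2)[OF a]
    by (intro continuous_intros) auto
  then have "disk_auto (- a) \<in> measurable S circle_borel"
    using measurable_circle_borel_continuous circle_auto(1)[OF a] S(2) by (simp cong: measurable_cong_sets)
  then have "represented circle_borel (\<lambda>g. \<integral>\<xi>. h \<xi> * g (disk_auto (- a) \<xi>) \<partial>S)"
    by (rule represented_pushforward[OF h])
  then show ?thesis
  proof (rule J_familyI)
    fix z assume z: "z \<in> unit_disk"
    have d: "disk_auto a z \<in> unit_disk" "disk_auto a 0 \<in> unit_disk"
      using disk_auto_in_unit_disk(1)[OF a] z by auto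
    have "(f \<circ> disk_auto a) z - (f \<circ> disk_auto a) 0
        = (\<integral>\<xi>. h \<xi> * ?k \<xi> (disk_auto a z) - h \<xi> * ?k \<xi> (disk_auto a 0) \<partial>S)"
      using f[OF d(1)] f[OF d(2)] i[OF d(1)] i[OF d(2)] by simp
    also have "\<dots> = (\<integral>\<xi>. h \<xi> * ?k (disk_auto (- a) \<xi>) z \<partial>S)"
    proof (rule Bochner_Integration.integral_cong[OF refl])
      fix \<xi> assume "\<xi> \<in> space S"
      then have "\<xi> \<in> sphere 0 1" using sp by simp
      from J_kernel_disk_auto[OF a this z]
      show "h \<xi> * ?k \<xi> (disk_auto a z) - h \<xi> * ?k \<xi> (disk_auto a 0) = h \<xi> * ?k (disk_auto (- a) \<xi>) z"
        by (simp only: right_diff_distrib[symmetric])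
    qed
    finally show "(f \<circ> disk_auto a) z - (f \<circ> disk_auto a) 0
        = (\<integral>\<xi>. h \<xi> * ?k (disk_auto (- a) \<xi>) z \<partial>S)" .
  qed
qed

theorem theorem1:
  shows "(\<forall>f. \<forall>\<mu>\<in>circle_measures. f analytic_on unit_disk \<longrightarrow>
            ((\<forall>z\<in>unit_disk. f z - f 0 = J_transform \<mu> z) \<longleftrightarrow>
             (\<forall>z\<in>unit_disk. deriv f z = K_transform \<mu> z))) \<and>
         (\<forall>\<alpha>\<ge>0. J_family \<subseteq> F_family \<alpha>) \<and>
         (\<forall>a f. -1 < a \<longrightarrow> a < 1 \<longrightarrow> f \<in> J_family \<longrightarrow>
            (\<lambda>z. (f \<circ> disk_auto a) z - (f \<circ> disk_auto a) 0) \<in> J_family)"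
proof (intro conjI allI ballI impI)
  show "J_family \<subseteq> F_family \<alpha>" if "0 \<le> \<alpha>" for \<alpha>
    using that J_family_subset_F_0 J_family_subset_F_pos by (cases "\<alpha> = 0") auto
qed (rule J_transform_iff_derivative J_family_disk_auto; assumption)+

end
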